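(* Let $\phi=\phi(x,t,\theta)$ be a fermionic (odd) superfield and let $L=(\mathcal{D}^3+\phi)(\mathcal{D}^3+\phi)=\partial_x^3+(\mathcal{D}\phi)\partial_x-\phi_x\mathcal{D}+(\mathcal{D}\phi_x)$. Then the supersymmetric Sawada-Kotera equation $$\phi_{t}+\phi_{xxxxx}+5\phi_{xxx}(\mathcal{D}\phi)+5\phi_{xx}(\mathcal{D}\phi_x)+5\phi_x(\mathcal{D}\phi)^2=0$$ admits the Lax representation $$\frac{\partial L}{\partial t}=\left[\,9\,(L^{5/3})_+,\;L\,\right],$$ i.e. the evolution of $\phi$ determined by this Lax equation is exactly the supersymmetric Sawada-Kotera equation.
   Context: Superspace has one even coordinate $x$ and one odd coordinate $\theta$; $\mathcal{D}=\partial_\theta+\theta\partial_x$ is the super derivative, so $\mathcal{D}^2=\partial_x$. Let $\mathcal{A}$ be the algebra of super differential polynomials in $\phi$: the free supercommutative algebra generated by $\mathcal{D}^k\phi$, $k\ge 0$, with $\phi$ odd (so $\mathcal{D}^k\phi$ has parity $k+1$ mod 2) and $\mathcal{D}$ acting as an odd derivation. $(\mathcal{D}f)$ with parentheses denotes $\mathcal{D}$ applied to $f$, and $f_x=(\mathcal{D}^2 f)$. Super pseudodifferential operators are formal series $\sum_{k\le N}a_k\mathcal{D}^k$ with $a_k\in\mathcal{A}$, composed using $\mathcal{D}a=(\mathcal{D}a)+(-1)^{|a|}a\mathcal{D}$; $(\cdot)_+$ is the projection to the differential part (terms with $k\ge 0$). The supercommutator is $[A,B]=AB-(-1)^{|A||B|}BA$.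 $L^{1/3}$ is the even operator with leading term $\partial_x$, coefficients in $\mathcal{A}$, whose cube is $L$, and $L^{5/3}=(L^{1/3})^5$. The time derivative $\partial/\partial t$ acts as an even derivation of $\mathcal{A}$ commuting with $\mathcal{D}$, applied to operators coefficientwise; $\phi_t$ is taken to be a super differential polynomial in $\phi$ without constant term. *)

theory Defs
  imports Complex_Main "HOL-Library.Poly_Mapping"
begin

section \<open>Super differential polynomials\<close>

text \<open>
  The letter \<open>k\<close> stands for the \<open>k\<close>-th super derivative of \<open>\<phi>\<close>, which has parity \<open>k + 1\<close>.
  Words under concatenation form the free monoid on these letters, so that the type
  \<open>word \<Rightarrow>\<^sub>0 'k\<close> with the convolution product is the free associative algebra over the field
  \<open>'k\<close>.
\<close>

datatype word = Word (letters: "nat list")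

instantiation word :: monoid_add
begin
definition zero_word :: word where "zero_word = Word []"
definition plus_word :: "word \<Rightarrow> word \<Rightarrow> word" where "plus_word u v = Word (letters u @ letters v)"
instance by standard (auto simp: zero_word_def plus_word_def)
end

abbreviation single :: "word \<Rightarrow> 'k::zero \<Rightarrow> word \<Rightarrow>\<^sub>0 'k" where "single \<equiv> Poly_Mapping.single"
abbreviation lookup :: "(word \<Rightarrow>\<^sub>0 'k::zero) \<Rightarrow> word \<Rightarrow> 'k" where "lookup \<equiv> Poly_Mapping.lookup"
abbreviation keys :: "(word \<Rightarrow>\<^sub>0 'k::zero) \<Rightarrow> word set" where "keys \<equiv> Poly_Mapping.keys"

definition wdeg :: "word \<Rightarrow> int" where
  "wdeg w = (\<Sum>k\<leftarrow>letters w. int k + 1)"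

text \<open>\<open>sgp n = (-1)\<^sup>n\<close> for an integer exponent.\<close>

definition sgp :: "int \<Rightarrow> 'a::ring_1" where
  "sgp n = (if even n then 1 else - 1)"

text \<open>
  The two-sided ideal of supercommutativity relations. As the characteristic is not 2, the
  instances \<open>i = j\<close> give that odd generators square to zero.
\<close>

inductive_set sc_ideal :: "(word \<Rightarrow>\<^sub>0 'k::field_char_0) set" where
  zero: "0 \<in> sc_ideal"
| gen: "single (Word [i, j]) 1 - sgp ((int i + 1) * (int j + 1)) * single (Word [j, i]) 1 \<in> sc_ideal"
| add: "f \<in> sc_ideal \<Longrightarrow> g \<in> sc_ideal \<Longrightarrow> f + g \<in> sc_ideal"
| multl: "f \<in> sc_ideal \<Longrightarrow> h * f \<in> sc_ideal"
| multr: "f \<in> sc_ideal \<Longrightarrow> f * h \<in> sc_ideal"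

lemma sc_ideal_uminus: "f \<in> sc_ideal \<Longrightarrow> - f \<in> sc_ideal"
  using sc_ideal.multl[of f "- 1"] by simp

lemma sc_ideal_diff: "f \<in> sc_ideal \<Longrightarrow> g \<in> sc_ideal \<Longrightarrow> f - g \<in> sc_ideal"
  using sc_ideal.add[of f "- g"] sc_ideal_uminus[of g] by simp

definition sc_rel :: "(word \<Rightarrow>\<^sub>0 'k::field_char_0) \<Rightarrow> (word \<Rightarrow>\<^sub>0 'k) \<Rightarrow> bool" where
  "sc_rel f g \<longleftrightarrow> f - g \<in> sc_ideal"

quotient_type (overloaded) 'k sdpoly = "word \<Rightarrow>\<^sub>0 ('k::field_char_0)" / sc_rel
proof (rule equivpI)
  show "reflp (sc_rel :: (word \<Rightarrow>\<^sub>0 'k) \<Rightarrow> _)" by (auto simp: reflp_def sc_rel_def sc_ideal.zero)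
  show "symp (sc_rel :: (word \<Rightarrow>\<^sub>0 'k) \<Rightarrow> _)"
    using sc_ideal_uminus by (fastforce simp: symp_def sc_rel_def)
  show "transp (sc_rel :: (word \<Rightarrow>\<^sub>0 'k) \<Rightarrow> _)"
  proof (rule transpI)
    fix f g h :: "word \<Rightarrow>\<^sub>0 'k"
    assume "sc_rel f g" "sc_rel g h"
    then show "sc_rel f h"
      using sc_ideal.add[of "f - g" "g - h"] by (simp add: sc_rel_def)
  qed
qed

lemma lookup_mult_0: "lookup (f * g) 0 = lookup f 0 * lookup g 0"
  for f g :: "word \<Rightarrow>\<^sub>0 'k::field_char_0"
proof -
  have zz: "u + v = 0 \<longleftrightarrow> u = 0 \<and> v = 0" for u v :: word
    by (cases u; cases v) (auto simp: plus_word_def zero_word_def)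
  have "lookup (f * g) 0 = (\<Sum>l. lookup f l * (\<Sum>q. lookup g q when 0 = l + q))"
    by (rule lookup_mult)
  also have "(\<lambda>l. lookup f l * (\<Sum>q. lookup g q when 0 = l + q))
      = (\<lambda>l. if l = 0 then lookup f 0 * lookup g 0 else 0)"
  proof
    fix l
    have "(\<lambda>q. lookup g q when 0 = l + q) = (\<lambda>q. if q = 0 then (if l = 0 then lookup g 0 else 0) else 0)"
      using zz[of l] by (auto simp: fun_eq_iff when_def)
    then show "lookup f l * (\<Sum>q. lookup g q when 0 = l + q)
      = (if l = 0 then lookup f 0 * lookup g 0 else 0)" by (simp only: Sum_any.delta) simp
  qed
  finally show ?thesis by simp
qed

lemma sc_ideal_lookup_0: "f \<in> sc_ideal \<Longrightarrow> lookup f 0 = 0"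
proof (induction rule: sc_ideal.induct)
  case (gen i j)
  then show ?case
    by (simp add: sgp_def lookup_minus lookup_mult_0 lookup_single zero_word_def when_def)
qed (simp_all add: lookup_add lookup_mult_0)

instantiation sdpoly :: (field_char_0) ring_1
begin

lift_definition zero_sdpoly :: "'a sdpoly" is 0 .
lift_definition one_sdpoly :: "'a sdpoly" is 1 .
lift_definition uminus_sdpoly :: "'a sdpoly \<Rightarrow> 'a sdpoly" is uminus
  by (metis minus_diff_minus sc_ideal_uminus sc_rel_def)
lift_definition plus_sdpoly :: "'a sdpoly \<Rightarrow> 'a sdpoly \<Rightarrow> 'a sdpoly" is plus
  by (metis add_diff_add sc_ideal.add sc_rel_def)
lift_definition minus_sdpoly :: "'a sdpoly \<Rightarrow> 'a sdpoly \<Rightarrow> 'a sdpoly" is minus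
  by (simp add: sc_rel_def) (metis (no_types, opaque_lifting) diff_diff_eq2 diff_add_eq sc_ideal_diff add_diff_eq diff_diff_eq add.commute)
lift_definition times_sdpoly :: "'a sdpoly \<Rightarrow> 'a sdpoly \<Rightarrow> 'a sdpoly" is times
proof -
  fix f f' g g' :: "word \<Rightarrow>\<^sub>0 'a"
  assume "sc_rel f f'" "sc_rel g g'"
  moreover have "f * g - f' * g' = (f - f') * g + f' * (g - g')" by (simp add: algebra_simps)
  ultimately show "sc_rel (f * g) (f' * g')"
    by (auto simp: sc_rel_def intro: sc_ideal.intros)
qed

instance
proof
  show "(0 :: 'a sdpoly) \<noteq> 1"
  proof
    assume "(0 :: 'a sdpoly) = 1"
    then have "sc_rel (0 :: word \<Rightarrow>\<^sub>0 'a) 1" by transfer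
    then show False
      using sc_ideal_lookup_0[of "0 - 1 :: word \<Rightarrow>\<^sub>0 'a"] by (simp add: sc_rel_def lookup_minus lookup_one)
  qed
qed (transfer; simp add: sc_rel_def sc_ideal.zero algebra_simps)+

end

lift_definition const :: "'k \<Rightarrow> 'k::field_char_0 sdpoly" is "\<lambda>c. single 0 c" .

lift_definition gen :: "nat \<Rightarrow> 'k::field_char_0 sdpoly" is "\<lambda>k. single (Word [k]) 1" .

lift_definition const_term :: "'k::field_char_0 sdpoly \<Rightarrow> 'k" is "\<lambda>f. lookup f 0"
  by (metis eq_iff_diff_eq_0 lookup_minus sc_ideal_lookup_0 sc_rel_def)

text \<open>\<open>homog p f\<close>: the element \<open>f\<close> is homogeneous of parity \<open>p\<close> mod 2.\<close>

definition homog :: "int \<Rightarrow> 'k::field_char_0 sdpoly \<Rightarrow> bool" where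
  "homog p f \<longleftrightarrow> (\<exists>h. f = abs_sdpoly h \<and> (\<forall>w \<in> keys h. even (wdeg w - p)))"


section \<open>Derivations\<close>

text \<open>Linear extension of a map defined on words.\<close>

definition lin :: "(word \<Rightarrow> 'k sdpoly) \<Rightarrow> (word \<Rightarrow>\<^sub>0 'k) \<Rightarrow> 'k::field_char_0 sdpoly" where
  "lin F f = (\<Sum>w \<in> keys f. const (lookup f w) * F w)"

text \<open>
  \<open>twist p\<close> maps a homogeneous element \<open>a\<close> of parity \<open>|a|\<close> to \<open>(-1)\<^sup>p\<^sup>|\<^sup>a\<^sup>| a\<close>.
\<close>

definition twist :: "int \<Rightarrow> 'k::field_char_0 sdpoly \<Rightarrow> 'k sdpoly" where
  "twist p a = lin (\<lambda>w. sgp (p * wdeg w) * abs_sdpoly (single w 1)) (rep_sdpoly a)"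

fun wder :: "int \<Rightarrow> (nat \<Rightarrow> 'k sdpoly) \<Rightarrow> nat list \<Rightarrow> 'k::field_char_0 sdpoly" where
  "wder p g [] = 0"
| "wder p g (k # u) = g k * abs_sdpoly (single (Word u) 1) + sgp (p * (int k + 1)) * gen k * wder p g u"

text \<open>
  The superderivation of parity \<open>p\<close> sending the \<open>k\<close>-th generator to \<open>g k\<close>. It is well defined,
  i.e. independent of the chosen representative, when \<open>g k\<close> has parity \<open>k + 1 + p\<close>;
  see \<open>sder_gen\<close> and \<open>sder_mult\<close> below.
\<close>

definition sder :: "int \<Rightarrow> (nat \<Rightarrow> 'k sdpoly) \<Rightarrow> 'k sdpoly \<Rightarrow> 'k::field_char_0 sdpoly" where
  "sder p g a = lin (\<lambda>w. wder p g (letters w)) (rep_sdpoly a)"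

definition sD :: "'k::field_char_0 sdpoly \<Rightarrow> 'k sdpoly" where
  "sD = sder 1 (\<lambda>k. gen (Suc k))"


lemma const_0 [simp]: "const 0 = 0" by transfer (simp add: sc_rel_def sc_ideal.zero)
lemma const_1 [simp]: "const 1 = 1" by transfer (simp add: sc_rel_def sc_ideal.zero)
lemma const_add: "const (c + d) = const c + const d"
  by transfer (simp add: sc_rel_def sc_ideal.zero single_add)
lemma const_mult: "const (c * d) = const c * const d"
  by transfer (simp add: sc_rel_def sc_ideal.zero mult_single)
lemma const_uminus: "const (- c) = - const c"
  by transfer (simp add: sc_rel_def sc_ideal.zero single_uminus)

lemma pm_induct [case_names single add]:
  assumes "\<And>w c. P (single w c)" "\<And>f g. P f \<Longrightarrow> P g \<Longrightarrow> P (f + g)"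
  shows "P (f :: word \<Rightarrow>\<^sub>0 'k::field_char_0)"
proof (induction f rule: update_induct)
  case const
  show ?case using assms(1)[of 0 0] by simp
next
  case (update f a b)
  have "Poly_Mapping.update a b f = f + single a b"
    using update(1) by (intro poly_mapping_eqI) (auto simp: lookup_update lookup_add lookup_single when_def in_keys_iff)
  then show ?case using assms update by simp
qed

lemma single_central: "single 0 c * f = f * single 0 c" for c :: "'k::field_char_0"
  by (induction f rule: pm_induct) (simp_all add: mult_single algebra_simps)

lemma const_central: "const c * a = a * const c"
  by transfer (simp add: sc_rel_def sc_ideal.zero single_central)

lemma const_lc: "a * (const c * b) = const c * (a * b)"
  by (metis const_central mult.assoc)

lemma abs_add: "abs_sdpoly (f + g) = abs_sdpoly f + abs_sdpoly g" by (simp add: plus_sdpoly.abs_eq)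
lemma abs_mult: "abs_sdpoly (f * g) = abs_sdpoly f * abs_sdpoly g" by (simp add: times_sdpoly.abs_eq)
lemma abs_uminus: "abs_sdpoly (- f) = - abs_sdpoly f" by (simp add: uminus_sdpoly.abs_eq)
lemma abs_0: "abs_sdpoly 0 = 0" by (simp add: zero_sdpoly.abs_eq)
lemma abs_1: "abs_sdpoly 1 = 1" by (simp add: one_sdpoly.abs_eq)

lemma abs_eq_iff: "abs_sdpoly f = abs_sdpoly g \<longleftrightarrow> f - g \<in> sc_ideal"
  by (simp add: sdpoly.abs_eq_iff sc_rel_def)

lemma rep_abs: "rep_sdpoly (abs_sdpoly f) - f \<in> sc_ideal"
  by (metis Quotient3_abs_rep Quotient3_sdpoly abs_eq_iff)

lemma abs_rep: "abs_sdpoly (rep_sdpoly a) = a"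
  by (metis Quotient3_abs_rep Quotient3_sdpoly)

lemma lin_superset:
  assumes "finite S" "keys f \<subseteq> S"
  shows "lin F f = (\<Sum>w\<in>S. const (lookup f w) * F w)"
  unfolding lin_def by (rule sum.mono_neutral_left) (use assms in \<open>auto simp: in_keys_iff\<close>)

lemma lin_add: "lin F (f + g) = lin F f + lin F g"
proof -
  define S where "S = keys f \<union> keys g"
  have "finite S" "keys f \<subseteq> S" "keys g \<subseteq> S" "keys (f + g) \<subseteq> S"
    using keys_add[of f g] by (auto simp: S_def)
  then show ?thesis
    by (simp add: lin_superset[of S] lookup_add const_add distrib_right sum.distrib)
qed

lemma lin_single: "lin F (single w c) = const c * F w"
  by (simp add: lin_superset[of "{w}"])

lemma lin_uminus: "lin F (- f) = - lin F f"
  by (simp add: lin_def const_uminus sum_negf)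

lemma lin_diff: "lin F (f - g) = lin F f - lin F g"
  using lin_add[of F f "- g"] by (simp add: lin_uminus)

lemma lin_0: "lin F 0 = 0" by (simp add: lin_def)

lemma abs_single: "abs_sdpoly (single w c) = const c * abs_sdpoly (single w 1)"
  by (simp add: const.abs_eq flip: abs_mult) (simp add: mult_single)

lemma lin_abs: "lin (\<lambda>w. abs_sdpoly (single w 1)) f = abs_sdpoly f"
  by (induction f rule: pm_induct) (metis abs_single lin_single, simp add: lin_add abs_add)

lemma sgp_add: "sgp (m + n) = sgp m * sgp n" by (simp add: sgp_def)
lemma sgp_even: "even n \<Longrightarrow> sgp n = 1" by (simp add: sgp_def)
lemma sgp_square [simp]: "sgp n * sgp n = 1" by (simp add: sgp_def)
lemma sgp_central: "sgp n * a = a * sgp n" by (simp add: sgp_def)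
lemma sgp_lc: "a * (sgp n * b) = sgp n * (a * b)" by (simp add: sgp_def)
lemma sgp_cong: "even (m - n) \<Longrightarrow> sgp m = sgp n" by (auto simp: sgp_def)

lemma wdeg_0 [simp]: "wdeg 0 = 0" by (simp add: wdeg_def zero_word_def)
lemma wdeg_add [simp]: "wdeg (u + v) = wdeg u + wdeg v" by (simp add: wdeg_def plus_word_def)
lemma wdeg_Word [simp]: "wdeg (Word []) = 0" "wdeg (Word (k # u)) = int k + 1 + wdeg (Word u)"
  by (simp_all add: wdeg_def)

lemma word_Cons: "single (Word (k # u)) (1::'k::field_char_0) = single (Word [k]) 1 * single (Word u) 1"
  by (simp add: mult_single plus_word_def)
lemma abs_Cons: "abs_sdpoly (single (Word (k # u)) 1) = gen k * abs_sdpoly (single (Word u) 1)"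
  by (simp only: word_Cons[of k u] abs_mult gen.abs_eq)
lemma abs_Nil: "abs_sdpoly (single (Word []) 1) = 1"
  by (simp add: one_sdpoly.abs_eq flip: single_one) (simp add: zero_word_def)

lemma gen_commute: "gen i * gen j = (sgp ((int i + 1) * (int j + 1)) * (gen j * gen i) :: 'k::field_char_0 sdpoly)"
proof -
  have w: "single (Word [i, j]) 1 = single (Word [i]) 1 * (single (Word [j]) 1 :: word \<Rightarrow>\<^sub>0 'k)" for i j
    by (simp add: mult_single plus_word_def)
  have "abs_sdpoly (single (Word [i, j]) 1)
      = abs_sdpoly (sgp ((int i + 1) * (int j + 1)) * single (Word [j, i]) (1::'k))"
    unfolding abs_eq_iff by (rule sc_ideal.gen)
  then show ?thesis
    by (auto simp: w sgp_def abs_mult gen.abs_eq abs_uminus abs_1 split: if_splits)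
qed

lemma word_gen_commute:
  "abs_sdpoly (single (Word u) 1) * gen j
     = (sgp (wdeg (Word u) * (int j + 1)) * (gen j * abs_sdpoly (single (Word u) 1)) :: 'k::field_char_0 sdpoly)"
proof (induction u)
  case Nil
  then show ?case by (simp add: abs_Nil sgp_even)
next
  case (Cons k u)
  have "abs_sdpoly (single (Word (k # u)) 1) * gen j
      = gen k * (abs_sdpoly (single (Word u) 1) * gen j :: 'k sdpoly)"
    by (simp add: abs_Cons mult.assoc)
  also have "\<dots> = sgp (wdeg (Word u) * (int j + 1)) * ((gen k * gen j) * abs_sdpoly (single (Word u) 1))"
    by (simp only: Cons mult.assoc sgp_lc[of "gen k"])
  also have "\<dots> = sgp (wdeg (Word (k # u)) * (int j + 1)) * (gen j * abs_sdpoly (single (Word (k # u)) 1))"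
  proof -
    have "sgp (wdeg (Word (k # u)) * (int j + 1)) = sgp (wdeg (Word u) * (int j + 1)) * (sgp ((int k + 1) * (int j + 1)) :: 'k sdpoly)"
      by (simp add: algebra_simps flip: sgp_add)
    then show ?thesis by (simp only: gen_commute[of k j] abs_Cons mult.assoc)
  qed
  finally show ?case .
qed

lemma homog_0 [simp]: "homog p 0" unfolding homog_def by (rule exI[of _ 0]) (simp add: abs_0)

lemma homog_add: "homog p a \<Longrightarrow> homog p b \<Longrightarrow> homog p (a + b)"
  unfolding homog_def using keys_add[where ?'b = 'a] by (fastforce simp: abs_add[symmetric])

lemma homog_mult:
  assumes "homog p a" "homog q b"
  shows "homog (p + q) (a * b)"
proof -
  obtain f g where fg: "a = abs_sdpoly f" "b = abs_sdpoly g"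
    "\<forall>w \<in> keys f. even (wdeg w - p)" "\<forall>w \<in> keys g. even (wdeg w - q)"
    using assms by (auto simp: homog_def)
  have "even (wdeg w - (p + q))" if w: "w \<in> keys (f * g)" for w
  proof -
    obtain u v where "u \<in> keys f" "v \<in> keys g" "w = u + v"
      using w keys_mult[of f g] by blast
    with fg have "even (wdeg u - p)" "even (wdeg v - q)" by blast+
    then have "even ((wdeg u - p) + (wdeg v - q))" by (rule dvd_add)
    moreover have "wdeg w - (p + q) = (wdeg u - p) + (wdeg v - q)" using \<open>w = u + v\<close> by simp
    ultimately show ?thesis by (simp only:)
  qed
  moreover have "a * b = abs_sdpoly (f * g)" by (simp only: fg(1,2) abs_mult)
  ultimately show ?thesis unfolding homog_def by blast
qed

lemma homog_single: "even (wdeg w - p) \<Longrightarrow> homog p (abs_sdpoly (single w c))"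
  unfolding homog_def by (rule exI[of _ "single w c"]) auto

lemma homog_const: "even p \<Longrightarrow> homog p (const c)"
  unfolding const.abs_eq by (rule homog_single) simp
lemma homog_gen: "even (int k + 1 - p) \<Longrightarrow> homog p (gen k)"
  unfolding gen.abs_eq by (rule homog_single) simp
lemma homog_uminus: "homog p a \<Longrightarrow> homog p (- a)"
  using homog_mult[of 0 "const (- 1)" p a] homog_const[of 0 "- 1"] by (simp add: const_uminus)
lemma homog_cong: "homog p a \<Longrightarrow> even (p - q) \<Longrightarrow> homog q a"
  unfolding homog_def by auto
lemma homog_sgp: "homog p a \<Longrightarrow> homog p (sgp n * a)"
  by (auto simp: sgp_def intro: homog_uminus)
lemma homog_sum: "(\<And>i. i \<in> S \<Longrightarrow> homog p (f i)) \<Longrightarrow> homog p (sum f S)"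
  by (induction S rule: infinite_finite_induct) (auto intro: homog_add)

lemma homog_gen_commute:
  assumes "homog p a"
  shows "a * gen j = sgp (p * (int j + 1)) * (gen j * a)"
proof -
  obtain h where h: "a = abs_sdpoly h" "\<forall>w \<in> keys h. even (wdeg w - p)"
    using assms by (auto simp: homog_def)
  have a: "a = (\<Sum>w\<in>keys h. const (lookup h w) * abs_sdpoly (single w 1))"
    using h lin_abs[of h] by (simp add: lin_def)
  have "const (lookup h w) * abs_sdpoly (single w 1) * gen j
      = sgp (p * (int j + 1)) * (gen j * (const (lookup h w) * abs_sdpoly (single w 1)))"
    if "w \<in> keys h" for w
  proof -
    have "even (wdeg w - p)" using h that by auto
    then have "even (wdeg w * (int j + 1) - p * (int j + 1))"
      by (metis dvd_mult2 left_diff_distrib)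
    then have "abs_sdpoly (single w 1) * gen j = sgp (p * (int j + 1)) * (gen j * abs_sdpoly (single w (1::'a)))"
      using word_gen_commute[of "letters w" j, where 'k='a] by (metis sgp_cong word.collapse)
    then show ?thesis by (simp only: mult.assoc const_lc[of "gen j"] sgp_lc[of "const _"])
  qed
  then show ?thesis
    by (simp add: a sum_distrib_left sum_distrib_right)
qed


lemma lin_sgp_mult: "lin F (sgp n * f) = sgp n * lin F f"
  by (simp add: sgp_def lin_uminus)

abbreviation twf :: "int \<Rightarrow> (word \<Rightarrow>\<^sub>0 'k) \<Rightarrow> 'k::field_char_0 sdpoly" where
  "twf p \<equiv> lin (\<lambda>w. sgp (p * wdeg w) * abs_sdpoly (single w 1))"

lemma abs_single_add: "abs_sdpoly (single (u + v) 1) = abs_sdpoly (single u 1) * abs_sdpoly (single v (1::'k::field_char_0))"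
  by (simp add: mult_single flip: abs_mult)

lemma twf_mult: "twf p (f * g) = twf p f * (twf p g :: 'k::field_char_0 sdpoly)"
proof (induction f rule: pm_induct)
  case (single u c)
  show ?case
  proof (induction g rule: pm_induct)
    case (single v d)
    have "const (c * d) * (sgp (p * wdeg (u + v)) * abs_sdpoly (single (u + v) 1))
      = (const c * const d) * ((sgp (p * wdeg u) * sgp (p * wdeg v)) * (abs_sdpoly (single u 1) * abs_sdpoly (single v (1::'k))))"
      by (simp add: const_mult sgp_add distrib_left abs_single_add)
    also have "\<dots> = const c * (sgp (p * wdeg u) * abs_sdpoly (single u 1)) * (const d * (sgp (p * wdeg v) * abs_sdpoly (single v 1)))"
      by (simp only: mult.assoc const_lc[of "sgp _" d] const_lc[of "abs_sdpoly _" d]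
          sgp_lc[of "abs_sdpoly _" "p * wdeg v"])
    finally show ?case by (simp add: mult_single lin_single)
  qed (simp add: distrib_left lin_add)
qed (simp add: distrib_right lin_add)

lemma twf_ideal: "f \<in> sc_ideal \<Longrightarrow> twf p f = (0 :: 'k::field_char_0 sdpoly)"
proof (induction rule: sc_ideal.induct)
  case (gen i j)
  have "twf p (single (Word [i, j]) (1::'k)) = sgp (p * (int i + 1 + (int j + 1))) * (gen i * gen j)" for i j
    by (simp add: lin_single abs_Cons abs_Nil)
  then show ?case
    using gen_commute[of i j, where 'k='k]
    by (simp only: lin_diff lin_sgp_mult sgp_lc[of "sgp _" "(int i + 1) * (int j + 1)"] add.commute[of "int i + 1"])
       simp
qed (simp_all add: lin_0 lin_add twf_mult)

lemma twist_abs: "twist p (abs_sdpoly f) = twf p f"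
  using twf_ideal[OF rep_abs, of p f] by (simp add: twist_def lin_diff)

lemma twist_add: "twist p (a + b) = twist p a + twist p b"
  by (induction a rule: sdpoly.abs_induct; induction b rule: sdpoly.abs_induct)
     (simp only: abs_add[symmetric] twist_abs lin_add)
lemma twist_mult: "twist p (a * b) = twist p a * twist p b"
  by (induction a rule: sdpoly.abs_induct; induction b rule: sdpoly.abs_induct)
     (simp only: abs_mult[symmetric] twist_abs twf_mult)
lemma twist_gen: "twist p (gen k) = sgp (p * (int k + 1)) * gen k"
  by (simp add: gen.abs_eq twist_abs lin_single)
lemma twist_const [simp]: "twist p (const c) = const c"
  using twist_abs[of p "single 0 c"] by (simp add: lin_single sgp_even abs_1 flip: const.abs_eq)
lemma twist_uminus: "twist p (- a) = - twist p a"
  by (induction a rule: sdpoly.abs_induct) (simp only: abs_uminus[symmetric] twist_abs lin_uminus)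
lemma twist_0 [simp]: "twist p 0 = 0" using twist_const[of p 0] by simp
lemma twist_1 [simp]: "twist p 1 = 1" using twist_const[of p 1] by simp
lemma twist_sgp_mult: "twist p (sgp n * a) = sgp n * twist p a"
  by (simp add: sgp_def twist_uminus)
lemma twist_sum: "twist p (sum f S) = (\<Sum>i\<in>S. twist p (f i))"
  by (induction S rule: infinite_finite_induct) (auto simp: twist_add)

lemma twist_homog:
  assumes "homog p a"
  shows "twist q a = sgp (q * p) * a"
proof -
  obtain h where h: "a = abs_sdpoly h" "\<forall>w \<in> keys h. even (wdeg w - p)"
    using assms by (auto simp: homog_def)
  have a: "a = (\<Sum>w\<in>keys h. const (lookup h w) * abs_sdpoly (single w 1))"
    using h lin_abs[of h] by (simp add: lin_def)
  have "sgp (q * wdeg w) = (sgp (q * p) :: 'a sdpoly)" if "w \<in> keys h" for w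
    by (rule sgp_cong) (metis h(2) that dvd_mult right_diff_distrib)
  then have "twist q a = (\<Sum>w\<in>keys h. const (lookup h w) * (sgp (q * p) * abs_sdpoly (single w 1)))"
    unfolding h twist_abs by (simp add: lin_def)
  also have "\<dots> = sgp (q * p) * (\<Sum>w\<in>keys h. const (lookup h w) * abs_sdpoly (single w 1))"
    unfolding sum_distrib_left by (simp only: sgp_lc[of "const _"])
  finally show ?thesis using a by simp
qed

lemma wder_append:
  "wder p g (u @ v) = wder p g u * abs_sdpoly (single (Word v) 1)
     + sgp (p * wdeg (Word u)) * abs_sdpoly (single (Word u) 1) * (wder p g v :: 'k::field_char_0 sdpoly)"
proof (induction u)
  case Nil
  then show ?case by (simp add: abs_Nil sgp_even)
next
  case (Cons k u)
  have "Word (u @ v) = Word u + Word v" by (simp add: plus_word_def)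
  moreover have "sgp (p * wdeg (Word (k # u))) = sgp (p * (int k + 1)) * (sgp (p * wdeg (Word u)) :: 'k sdpoly)"
    by (simp add: algebra_simps flip: sgp_add)
  ultimately show ?case
    by (simp only: append_Cons wder.simps Cons abs_Cons abs_single_add distrib_left distrib_right
        mult.assoc add.assoc sgp_lc[of "gen k"])
qed

abbreviation sdf :: "int \<Rightarrow> (nat \<Rightarrow> 'k sdpoly) \<Rightarrow> (word \<Rightarrow>\<^sub>0 'k) \<Rightarrow> 'k::field_char_0 sdpoly" where
  "sdf p g \<equiv> lin (\<lambda>w. wder p g (letters w))"

lemma sdf_mult: "sdf p g (f * h) = sdf p g f * abs_sdpoly h + twf p f * (sdf p g h :: 'k::field_char_0 sdpoly)"
proof (induction f rule: pm_induct)
  case (single u c)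
  show ?case
  proof (induction h rule: pm_induct)
    case (single v d)
    have "wder p g (letters (u + v)) = wder p g (letters u) * abs_sdpoly (single v 1)
       + sgp (p * wdeg u) * abs_sdpoly (single u 1) * wder p g (letters v)"
      using wder_append[of p g "letters u" "letters v"] by (simp add: plus_word_def)
    then have "sdf p g (single u c * single v d) = const c * const d * (wder p g (letters u) * abs_sdpoly (single v 1)
       + sgp (p * wdeg u) * abs_sdpoly (single u 1) * wder p g (letters v))"
      by (simp add: mult_single lin_single const_mult)
    also have "\<dots> = const c * wder p g (letters u) * (const d * abs_sdpoly (single v 1))
       + const c * (sgp (p * wdeg u) * abs_sdpoly (single u 1)) * (const d * wder p g (letters v))"
      by (simp only: mult.assoc distrib_left const_lc[of "sgp _" d] const_lc[of "abs_sdpoly _" d]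
          const_lc[of "wder _ _ _" d])
    finally show ?case by (simp add: lin_single flip: abs_single)
  qed (simp add: distrib_left lin_add abs_add)
qed (simp add: distrib_right lin_add abs_add)

lemma sdf_ideal:
  fixes g :: "nat \<Rightarrow> 'k::field_char_0 sdpoly"
  assumes g: "\<And>k. homog (int k + 1 + p) (g k)"
  shows "f \<in> sc_ideal \<Longrightarrow> sdf p g f = 0"
proof (induction rule: sc_ideal.induct)
  case (gen i j)
  have c: "g i * gen j = sgp ((int i + 1 + p) * (int j + 1)) * (gen j * g i)" for i j
    by (rule homog_gen_commute[OF g])
  have "sgp ((int i + 1) * (int j + 1)) * sgp ((int j + 1 + p) * (int i + 1)) = (sgp (p * (int i + 1)) :: 'k sdpoly)"
    unfolding sgp_add[symmetric] by (rule sgp_cong) (simp add: algebra_simps)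
  moreover have "sgp ((int i + 1) * (int j + 1)) * sgp (p * (int j + 1)) = (sgp ((int i + 1 + p) * (int j + 1)) :: 'k sdpoly)"
    unfolding sgp_add[symmetric] by (rule sgp_cong) (simp add: algebra_simps)
  ultimately have "g i * gen j + sgp (p * (int i + 1)) * (gen i * g j)
      = sgp ((int i + 1) * (int j + 1)) * (g j * gen i + sgp (p * (int j + 1)) * (gen j * g i))"
    by (simp add: c distrib_left flip: mult.assoc)
  then show ?case
    by (simp add: lin_diff lin_sgp_mult lin_single abs_Cons abs_Nil mult.assoc)
next
  case (multl f h)
  then show ?case using abs_eq_iff[of f 0] by (simp add: sdf_mult abs_0)
next
  case (multr f h)
  then show ?case by (simp add: sdf_mult twf_ideal)
qed (simp_all add: lin_0 lin_add)

context
  fixes p :: int and g :: "nat \<Rightarrow> 'k::field_char_0 sdpoly"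
  assumes g: "\<And>k. homog (int k + 1 + p) (g k)"
begin

lemma sder_abs: "sder p g (abs_sdpoly f) = sdf p g f"
  using sdf_ideal[OF g rep_abs, of f] by (simp add: sder_def lin_diff)

lemma sder_add: "sder p g (a + b) = sder p g a + sder p g b"
  by (induction a rule: sdpoly.abs_induct; induction b rule: sdpoly.abs_induct)
     (simp only: abs_add[symmetric] sder_abs lin_add)

lemma sder_mult: "sder p g (a * b) = sder p g a * b + twist p a * sder p g b"
  by (induction a rule: sdpoly.abs_induct; induction b rule: sdpoly.abs_induct)
     (simp only: abs_mult[symmetric] sder_abs twist_abs sdf_mult)

lemma sder_const: "sder p g (const c) = 0"
  by (simp add: const.abs_eq sder_abs lin_single zero_word_def)

lemma sder_gen: "sder p g (gen k) = g k"
  by (simp add: gen.abs_eq sder_abs lin_single abs_Nil)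

lemma homog_sder:
  assumes "homog q a"
  shows "homog (q + p) (sder p g a)"
proof -
  have w: "homog (wdeg (Word u) + p) (wder p g u)" for u
  proof (induction u)
    case (Cons k u)
    have "homog ((int k + 1 + p) + wdeg (Word u)) (g k * abs_sdpoly (single (Word u) 1))"
      by (intro homog_mult g homog_single) simp
    moreover have "homog ((int k + 1) + (wdeg (Word u) + p)) (sgp (p * (int k + 1)) * gen k * wder p g u)"
      unfolding mult.assoc by (intro homog_sgp homog_mult homog_gen Cons) simp
    ultimately show ?case by (simp add: homog_add ac_simps)
  qed simp
  obtain h where h: "a = abs_sdpoly h" "\<forall>w \<in> keys h. even (wdeg w - q)"
    using assms by (auto simp: homog_def)
  show ?thesis unfolding h sder_abs lin_def
  proof (rule homog_sum)
    fix w assume "w \<in> keys h"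
    then have "homog (0 + (wdeg w + p)) (const (lookup h w) * wder p g (letters w))"
      using w[of "letters w"] by (intro homog_mult homog_const) auto
    then show "homog (q + p) (const (lookup h w) * wder p g (letters w))"
      by (rule homog_cong) (use h(2) \<open>w \<in> keys h\<close> in auto)
  qed
qed

end

lemma homog_gen_Suc: "homog (int k + 1 + 1) (gen (Suc k))" by (rule homog_gen) simp

lemma sD_gen: "sD (gen k) = gen (Suc k)"
  unfolding sD_def by (rule sder_gen[OF homog_gen_Suc])
lemma sD_add: "sD (a + b) = sD a + sD b"
  unfolding sD_def by (rule sder_add[OF homog_gen_Suc])
lemma sD_mult: "sD (a * b) = sD a * b + twist 1 a * sD b"
  unfolding sD_def by (rule sder_mult[OF homog_gen_Suc])
lemma sD_const: "sD (const c) = 0"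
  unfolding sD_def by (rule sder_const[OF homog_gen_Suc])
lemma homog_sD: "homog p a \<Longrightarrow> homog (p + 1) (sD a)"
  unfolding sD_def by (rule homog_sder[OF homog_gen_Suc])
lemma sD_0 [simp]: "sD 0 = 0" using sD_const[of 0] by simp
lemma sD_1 [simp]: "sD 1 = 0" using sD_const[of 1] by simp
lemma sD_uminus: "sD (- a) = - sD a" using sD_add[of a "- a"] by (simp add: eq_neg_iff_add_eq_0 add.commute)
lemma sD_sgp_mult: "sD (sgp n * a) = sgp n * sD a" by (simp add: sgp_def sD_uminus)
lemma sD_const_mult: "sD (const c * a) = const c * sD a" by (simp add: sD_mult sD_const)
lemma sD_sum: "sD (sum f S) = (\<Sum>i\<in>S. sD (f i))"
  by (induction S rule: infinite_finite_induct) (auto simp: sD_add)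

lemma sdpoly_induct [case_names const gen add mult]:
  assumes "\<And>c. P (const c)" "\<And>k. P (gen k)"
    "\<And>a b. P a \<Longrightarrow> P b \<Longrightarrow> P (a + b)" "\<And>a b. P a \<Longrightarrow> P b \<Longrightarrow> P (a * b)"
  shows "P a"
proof -
  have w: "P (abs_sdpoly (single (Word u) 1))" for u
    by (induction u) (use assms(1)[of 1] assms(2,4) in \<open>auto simp: abs_Nil abs_Cons\<close>)
  have "P (abs_sdpoly f)" for f
  proof (induction f rule: pm_induct)
    case (single w c)
    show ?case using assms(4)[OF assms(1)[of c] w[of "letters w"]] by (simp add: abs_single[of w c])
  qed (simp add: abs_add assms)
  from this[of "rep_sdpoly a"] show ?thesis by (simp add: abs_rep)
qed

lemma twist_twist: "twist p (twist q a) = twist (p + q) a"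
proof (induction a rule: sdpoly_induct)
  case (gen k)
  show ?case
    by (simp only: twist_gen twist_sgp_mult distrib_right sgp_add mult.assoc sgp_lc[of "sgp _" "p * (int k + 1)"])
qed (simp_all add: twist_add twist_mult)
lemma twist_even: "even p \<Longrightarrow> twist p a = a"
  by (induction a rule: sdpoly_induct) (simp_all add: twist_add twist_mult twist_gen sgp_even)
lemma twist_cong: "even (p - q) \<Longrightarrow> twist p a = twist q a"
  using twist_twist[of "p - q" q a] by (simp add: twist_even)
lemma sD_twist: "sD (twist p a) = sgp p * twist p (sD a)"
proof (induction a rule: sdpoly_induct)
  case (gen k)
  have "sgp (p * (int k + 1)) = (sgp p * sgp (p * (int (Suc k) + 1)) :: 'a sdpoly)"
    unfolding sgp_add[symmetric] by (rule sgp_cong) (simp add: algebra_simps)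
  then show ?case by (simp only: twist_gen sD_sgp_mult sD_gen mult.assoc)
next
  case (mult a b)
  have "sD (twist p (a * b)) = sgp p * twist p (sD a) * twist p b + twist 1 (twist p a) * (sgp p * twist p (sD b))"
    by (simp add: twist_mult sD_mult mult)
  also have "\<dots> = sgp p * twist p (sD (a * b))"
    by (simp add: sD_mult twist_add twist_mult twist_twist distrib_left mult.assoc add.commute[of p 1]
        sgp_lc[of "twist _ _" p])
  finally show ?case .
qed (simp_all add: sD_const sD_add twist_add distrib_left)

definition even_derivation :: "('k sdpoly \<Rightarrow> 'k::field_char_0 sdpoly) \<Rightarrow> bool" where
  "even_derivation d \<longleftrightarrow>
     (\<forall>a b. d (a + b) = d a + d b) \<and>
     (\<forall>c a. d (const c * a) = const c * d a) \<and>
     (\<forall>a b. d (a * b) = d a * b + a * d b) \<and>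
     (\<forall>p a. homog p a \<longrightarrow> homog p (d a))"

definition dx :: "'k::field_char_0 sdpoly \<Rightarrow> 'k sdpoly" where "dx a = sD (sD a)"

definition phi :: "'k::field_char_0 sdpoly" where "phi = gen 0"

lemma phi_odd: "homog 1 phi" unfolding phi_def by (rule homog_gen) simp

lemma sD_funpow_phi: "(sD ^^ k) phi = gen k"
  by (induction k) (simp_all add: phi_def sD_gen)

text \<open>Every odd right-hand side \<open>P\<close> defines an evolution \<open>\<phi>\<^sub>t = P\<close>.\<close>

lemma ex_evolution:
  fixes P :: "'k::field_char_0 sdpoly"
  assumes "homog 1 P"
  shows "\<exists>d. even_derivation d \<and> (\<forall>a. d (sD a) = sD (d a)) \<and> d phi = P"
proof -
  define g where "g = (\<lambda>k. (sD ^^ k) P)"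
  have g: "homog (int k + 1 + 0) (g k)" for k
  proof (induction k)
    case 0
    show ?case using assms by (simp add: g_def)
  next
    case (Suc k)
    show ?case using homog_sD[OF Suc] by (simp add: g_def add.commute)
  qed
  define d where "d = sder 0 g"
  have m: "d (a * b) = d a * b + a * d b" for a b
    using sder_mult[OF g, of a b] by (simp add: d_def twist_even)
  have a: "d (a + b) = d a + d b" for a b
    unfolding d_def by (rule sder_add[OF g])
  have c: "d (const c) = 0" for c
    unfolding d_def by (rule sder_const[OF g])
  have d_gen: "d (gen k) = g k" for k
    unfolding d_def by (rule sder_gen[OF g])
  have h: "homog p a \<Longrightarrow> homog p (d a)" for p a
    unfolding d_def using homog_sder[OF g, of p a] by simp
  have u: "d (- a) = - d a" for a
    using m[of "const (- 1)" a] c[of "- 1"] by (simp add: const_uminus)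
  have d0: "d 0 = 0" using c[of 0] by simp
  have t: "d (twist 1 a) = twist 1 (d a)" for a
  proof (induction a rule: sdpoly_induct)
    case (gen k)
    have "twist 1 (g k) = sgp (int k + 1) * g k" using twist_homog[OF g, of 1 k] by simp
    then show ?case by (simp add: twist_gen d_gen sgp_def u)
  qed (simp_all add: c a m twist_add twist_mult)
  have "d (sD b) = sD (d b)" for b
  proof (induction b rule: sdpoly_induct)
    case (gen k)
    show ?case by (simp add: sD_gen d_gen) (simp add: g_def)
  qed (simp_all add: c d0 a m sD_const sD_add sD_mult t algebra_simps)
  moreover have "even_derivation d"
    using a c m h by (auto simp: even_derivation_def)
  moreover have "d phi = P" by (simp add: phi_def d_gen g_def)
  ultimately show ?thesis by blast
qed


section \<open>Super pseudodifferential operators\<close>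

text \<open>\<open>coeff A k\<close> is the coefficient of the \<open>k\<close>-th power of the super derivative, written to its left.\<close>

typedef (overloaded) 'k spdo = "{a :: int \<Rightarrow> 'k::field_char_0 sdpoly. \<exists>N. \<forall>k>N. a k = 0}"
  morphisms coeff Spdo
  by (auto intro: exI[of _ "\<lambda>_. 0"])

setup_lifting type_definition_spdo

lemma spdo_eqI: "(\<And>n. coeff A n = coeff B n) \<Longrightarrow> A = B"
  by (simp add: coeff_inject[symmetric] fun_eq_iff)

text \<open>
  Iterating the rule \<open>\<D>a = (\<D>a) + (-1)\<^sup>|\<^sup>a\<^sup>| a\<D>\<close> and its inverse gives, for every integer \<open>n\<close>,
  \<open>\<D>\<^sup>n a = \<Sum>\<^sub>j [n; j] (-1)\<^sup>|\<^sup>a\<^sup>|\<^sup>(\<^sup>n\<^sup>-\<^sup>j\<^sup>) (\<D>\<^sup>j a) \<D>\<^sup>n\<^sup>-\<^sup>j\<close> with the superbinomial coefficients \<open>[n; j]\<close> of Manin and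
  Radul. That this is the intended composition is confirmed below: it is associative (see the
  \<open>ring_1\<close> instance) and satisfies \<open>Dop_mult_Dop\<close> and \<open>Dop_mulop\<close>.
\<close>

definition sbinom :: "int \<Rightarrow> nat \<Rightarrow> 'k::field_char_0" where
  "sbinom n j = (if even n \<and> odd j then 0 else of_int (n div 2) gchoose (j div 2))"

text \<open>
  \<open>dpow i b n\<close> is the coefficient of \<open>\<D>\<^sup>n\<close> in \<open>\<D>\<^sup>i (\<Sum>\<^sub>k b\<^sub>k \<D>\<^sup>k)\<close>. All sums below have finite support.
\<close>

definition dpow :: "int \<Rightarrow> (int \<Rightarrow> 'k sdpoly) \<Rightarrow> int \<Rightarrow> 'k::field_char_0 sdpoly" where
  "dpow i b n = (\<Sum>j. const (sbinom i j) * (sD ^^ j) (twist (i - int j) (b (n - i + int j))))"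

definition opcomp :: "(int \<Rightarrow> 'k sdpoly) \<Rightarrow> (int \<Rightarrow> 'k sdpoly) \<Rightarrow> int \<Rightarrow> 'k::field_char_0 sdpoly" where
  "opcomp a b n = (\<Sum>i. a i * dpow i b n)"

definition bdd :: "int \<Rightarrow> (int \<Rightarrow> 'k::field_char_0 sdpoly) \<Rightarrow> bool" where
  "bdd N a \<longleftrightarrow> (\<forall>k>N. a k = 0)"

lemma sbinom_0 [simp]: "sbinom i 0 = 1" by (simp add: sbinom_def)

lemma sbinom_zero_left: "sbinom 0 j = (if j = 0 then 1 else 0)"
  by (auto simp: sbinom_def gbinomial_0_left elim!: oddE evenE)

lemma sbinom_Suc: "sbinom (i + 1) (Suc j) = sgp (int (Suc j)) * sbinom i (Suc j) + (sbinom i j :: 'k::field_char_0)"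
proof (cases "even i")
  case True
  then show ?thesis by (auto simp: sbinom_def sgp_def elim!: evenE oddE)
next
  case False
  then obtain m where i: "i = 2 * m + 1" by (elim oddE)
  show ?thesis
  proof (cases "even j")
    case True
    then show ?thesis by (auto simp: sbinom_def sgp_def i elim!: evenE)
  next
    case False
    then obtain l where j: "j = 2 * l + 1" by (elim oddE)
    have "(2 * m + 1 + 1) div 2 = m + 1" by simp
    then show ?thesis
      using gbinomial_Suc_Suc[of "of_int m :: 'k" l]
      by (simp add: sbinom_def sgp_def i j add.commute)
  qed
qed

lemma sD_funpow_0 [simp]: "(sD ^^ j) 0 = 0" by (induction j) auto

lemma sD_funpow_add: "(sD ^^ j) (a + b) = (sD ^^ j) a + (sD ^^ j) b"
  by (induction j) (auto simp: sD_add)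

lemma twist_sD_funpow: "twist 1 ((sD ^^ j) a) = sgp (int j) * (sD ^^ j) (twist 1 a)"
proof (induction j)
  case (Suc j)
  have "twist 1 (sD b) = - sD (twist 1 b)" for b :: "'a sdpoly"
    using sD_twist[of 1 b] by (simp add: sgp_def)
  then show ?case using Suc by (simp add: sD_sgp_mult) (simp add: sgp_def)
qed (simp add: sgp_def)

lemma dpow_sum:
  assumes "bdd N b" "N < n - i + int J"
  shows "dpow i b n = (\<Sum>j<J. const (sbinom i j) * (sD ^^ j) (twist (i - int j) (b (n - i + int j))))"
  unfolding dpow_def
proof (rule Sum_any.expand_superset)
  have "b (n - i + int j) = 0" if "J \<le> j" for j
    using assms that by (auto simp: bdd_def)
  then show "{j. const (sbinom i j) * (sD ^^ j) (twist (i - int j) (b (n - i + int j))) \<noteq> 0} \<subseteq> {..<J}"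
    by (force simp: not_less[symmetric])
qed simp

lemma dpow_vanish: "bdd N b \<Longrightarrow> N + i < n \<Longrightarrow> dpow i b n = 0"
  using dpow_sum[of N b n i 0] by simp

lemma bdd_dpow: "bdd N b \<Longrightarrow> bdd (N + i) (dpow i b)"
  by (auto simp: bdd_def[of "N + i"] dpow_vanish)

lemma bdd_mono: "bdd N b \<Longrightarrow> N \<le> M \<Longrightarrow> bdd M b" by (auto simp: bdd_def)

lemma comp_sum:
  assumes "bdd M a" "bdd N b" "finite S" "{n - N..M} \<subseteq> S"
  shows "opcomp a b n = (\<Sum>i\<in>S. a i * dpow i b n)"
  unfolding opcomp_def
proof (rule Sum_any.expand_superset)
  have "i \<in> {n - N..M}" if "a i * dpow i b n \<noteq> 0" for i
  proof -
    have "a i \<noteq> 0" "dpow i b n \<noteq> 0" using that by auto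
    then have "\<not> M < i" "\<not> N + i < n"
      using assms(1) dpow_vanish[OF assms(2)] by (auto simp: bdd_def)
    then show ?thesis by auto
  qed
  then show "{i. a i * dpow i b n \<noteq> 0} \<subseteq> S" using assms(4) by blast
qed (rule assms)

lemma bdd_comp: "bdd M a \<Longrightarrow> bdd N b \<Longrightarrow> bdd (M + N) (opcomp a b)"
  unfolding bdd_def[of "M + N"] by (auto simp: comp_sum[where M = M and N = N and S = "{}"])

lemma dpow_add:
  assumes "bdd N b" "bdd N c"
  shows "dpow i (\<lambda>k. b k + c k) n = dpow i b n + dpow i c n"
proof -
  have "bdd N (\<lambda>k. b k + c k)" using assms by (auto simp: bdd_def)
  moreover have "N < n - i + int (nat (N - n + i + 1))" by simp
  ultimately show ?thesis using assms
    by (simp add: dpow_sum[where N = N and J = "nat (N - n + i + 1)"] twist_add sD_funpow_add distrib_left sum.distrib)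
qed

lemma dpow_zero: "dpow 0 b = b"
proof
  fix n
  have "(\<lambda>j. const (sbinom 0 j) * (sD ^^ j) (twist (0 - int j) (b (n - 0 + int j)))) = (\<lambda>j. if j = 0 then b n else 0)"
    by (auto simp: fun_eq_iff sbinom_zero_left twist_even)
  then show "dpow 0 b n = b n" by (simp only: dpow_def Sum_any.delta)
qed

text \<open>Left composition with the super derivative.\<close>

definition ell :: "(int \<Rightarrow> 'k sdpoly) \<Rightarrow> int \<Rightarrow> 'k::field_char_0 sdpoly" where
  "ell b n = sD (b n) + twist 1 (b (n - 1))"

lemma bdd_ell: "bdd N b \<Longrightarrow> bdd (N + 1) (ell b)"
  by (auto simp: bdd_def ell_def)

lemma dpow_step:
  fixes b :: "int \<Rightarrow> 'k::field_char_0 sdpoly"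
  assumes "bdd N b"
  shows "dpow (i + 1) b = ell (dpow i b)"
proof
  fix n
  define J where "J = nat (N - n + i + 1)"
  define f where "f j = b (n - (i + 1) + int j)" for j
  have J: "N < n - i + int J" "N < (n - 1) - i + int (Suc J)" "N < n - (i + 1) + int (Suc J)"
    by (simp_all add: J_def)
  have e: "n - i + int j = n - (i + 1) + int (Suc j)" "n - 1 - i + int j = n - (i + 1) + int j" for j by simp_all
  have 1: "sD (dpow i b n) = (\<Sum>j<J. const (sbinom i j) * (sD ^^ Suc j) (twist (i + 1 - int (Suc j)) (f (Suc j))))"
    unfolding dpow_sum[OF assms J(1)] e(1) f_def[symmetric] by (simp add: sD_sum sD_const_mult)
  have tt: "twist 1 (const c * (sD ^^ j) (twist (i - int j) x))
      = const c * sgp (int j) * (sD ^^ j) (twist (i + 1 - int j) x)" for c j and x :: "'k sdpoly"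
    by (simp add: twist_mult twist_sD_funpow twist_twist mult.assoc add.commute add_diff_eq)
  have 2: "twist 1 (dpow i b (n - 1)) = (\<Sum>j<Suc J. const (sbinom i j) * sgp (int j) * (sD ^^ j) (twist (i + 1 - int j) (f j)))"
    unfolding dpow_sum[OF assms J(2)] e(2) f_def[symmetric] twist_sum tt ..
  have sc: "const (sgp m * c) = const c * sgp m" for m and c :: 'k
    by (simp add: sgp_def const_uminus)
  have "dpow (i + 1) b n = (\<Sum>j<Suc J. const (sbinom (i + 1) j) * (sD ^^ j) (twist (i + 1 - int j) (f j)))"
    unfolding dpow_sum[OF assms J(3)] f_def ..
  also have "\<dots> = twist (i + 1) (f 0) + (\<Sum>j<J. const (sbinom (i + 1) (Suc j)) * (sD ^^ Suc j) (twist (i + 1 - int (Suc j)) (f (Suc j))))"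
    by (simp only: sum.lessThan_Suc_shift) simp
  also have "\<dots> = sD (dpow i b n) + twist 1 (dpow i b (n - 1))"
    unfolding 1 2 sum.lessThan_Suc_shift sbinom_Suc const_add sc distrib_right sum.distrib
    by (simp add: sgp_even)
  finally show "dpow (i + 1) b n = ell (dpow i b) n" by (simp add: ell_def)
qed

lemma ell_inj:
  assumes "bdd N b" "bdd N c" "ell b = ell c"
  shows "b = c"
proof -
  have ind: "\<forall>k > N - int m. b k = c k" for m
  proof (induction m)
    case 0
    then show ?case using assms by (auto simp: bdd_def)
  next
    case (Suc m)
    let ?k = "N - int m"
    have "ell b (?k + 1) = ell c (?k + 1)" using assms by simp
    then have "twist 1 (b ?k) = twist 1 (c ?k)" using Suc by (simp add: ell_def)
    then have "twist 1 (twist 1 (b ?k)) = twist 1 (twist 1 (c ?k))" by simp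
    then have "b ?k = c ?k" by (simp add: twist_twist twist_even)
    then show ?case using Suc by (metis add.commute add_le_imp_le_diff diff_diff_eq linorder_not_le nle_le of_nat_Suc order_le_less zle_diff1_eq zless_imp_add1_zle)
  qed
  show ?thesis
  proof
    fix k show "b k = c k" using ind[of "nat (N - k + 1)"] by simp
  qed
qed

lemma ell_comp:
  assumes "bdd M a" "bdd N b"
  shows "ell (opcomp a b) = opcomp (ell a) b"
proof
  fix n
  define S where "S = {n - N - 1..M}"
  have S: "finite S" "{n - N..M} \<subseteq> S" "{n - 1 - N..M} \<subseteq> S" by (auto simp: S_def)
  have fin: "finite {n - N - 1..M + 1}" by simp
  have "ell (opcomp a b) n = sD (\<Sum>i\<in>S. a i * dpow i b n) + twist 1 (\<Sum>i\<in>S. a i * dpow i b (n - 1))"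
    using comp_sum[OF assms S(1,2)] comp_sum[OF assms S(1,3)] by (simp add: ell_def)
  also have "\<dots> = (\<Sum>i\<in>S. sD (a i) * dpow i b n) + (\<Sum>i\<in>S. twist 1 (a i) * dpow (i + 1) b n)"
    by (simp add: sD_sum twist_sum sD_mult twist_mult sum.distrib dpow_step[OF assms(2)] ell_def distrib_left)
  also have "(\<Sum>i\<in>S. sD (a i) * dpow i b n) = (\<Sum>i\<in>{n - N - 1..M + 1}. sD (a i) * dpow i b n)"
    by (rule sum.mono_neutral_left) (use assms in \<open>auto simp: S_def bdd_def\<close>)
  also have "(\<Sum>i\<in>S. twist 1 (a i) * dpow (i + 1) b n) = (\<Sum>i\<in>{n - N..M + 1}. twist 1 (a (i - 1)) * dpow i b n)"
    by (rule sum.reindex_bij_witness[of _ "\<lambda>i. i - 1" "\<lambda>i. i + 1"]) (auto simp: S_def)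
  also have "\<dots> = (\<Sum>i\<in>{n - N - 1..M + 1}. twist 1 (a (i - 1)) * dpow i b n)"
    by (rule sum.mono_neutral_left) (use dpow_vanish[OF assms(2)] in auto)
  also have "(\<Sum>i\<in>{n - N - 1..M + 1}. sD (a i) * dpow i b n) + \<dots> = opcomp (ell a) b n"
    by (subst comp_sum[OF bdd_ell[OF assms(1)] assms(2) fin]) (auto simp: ell_def distrib_right sum.distrib)
  finally show "ell (opcomp a b) n = opcomp (ell a) b n" .
qed

lemma dpow_comp:
  assumes "bdd M a" "bdd N b"
  shows "dpow i (opcomp a b) = opcomp (dpow i a) b"
proof (induction i rule: int_induct[where k = 0])
  case base
  show ?case by (simp add: dpow_zero)
next
  case (step1 i)
  then show ?case
    by (simp add: dpow_step[OF bdd_comp[OF assms]] dpow_step[OF assms(1)] ell_comp[OF bdd_dpow[OF assms(1)] assms(2)])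
next
  case (step2 i)
  have *: "ell (dpow (i - 1) (opcomp a b)) = ell (opcomp (dpow (i - 1) a) b)"
    using step2 dpow_step[OF bdd_comp[OF assms], of "i - 1"] dpow_step[OF assms(1), of "i - 1"]
    by (simp add: ell_comp[OF bdd_dpow[OF assms(1)] assms(2)])
  have b1: "bdd (M + N + (i - 1)) (dpow (i - 1) (opcomp a b))"
    by (intro bdd_dpow bdd_comp assms)
  have b2: "bdd (M + N + (i - 1)) (opcomp (dpow (i - 1) a) b)"
    using bdd_comp[OF bdd_dpow[OF assms(1)] assms(2), of "i - 1"] by (simp add: algebra_simps)
  show ?case by (rule ell_inj[OF b1 b2 *])
qed

lemma comp_assoc:
  assumes "bdd M a" "bdd N b" "bdd K c"
  shows "opcomp (opcomp a b) c = opcomp a (opcomp b c)"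
proof
  fix n
  define S T where "S = {n - K - N..M}" and "T = {n - K..M + N}"
  have "opcomp a (opcomp b c) n = (\<Sum>i\<in>S. a i * opcomp (dpow i b) c n)"
    using comp_sum[OF assms(1) bdd_comp[OF assms(2,3)], of S n]
    by (simp add: S_def dpow_comp[OF assms(2,3)] algebra_simps)
  also have "\<dots> = (\<Sum>i\<in>S. \<Sum>k\<in>T. a i * (dpow i b k * dpow k c n))"
    unfolding sum_distrib_left[symmetric]
    by (intro sum.cong arg_cong2[where f = times] refl comp_sum[OF bdd_dpow[OF assms(2)] assms(3)])
       (auto simp: S_def T_def)
  also have "\<dots> = (\<Sum>k\<in>T. (\<Sum>i\<in>S. a i * dpow i b k) * dpow k c n)"
    by (subst sum.swap) (simp add: sum_distrib_right mult.assoc)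
  also have "\<dots> = (\<Sum>k\<in>T. opcomp a b k * dpow k c n)"
    by (intro sum.cong arg_cong2[where f = times] refl comp_sum[OF assms(1,2), symmetric])
       (auto simp: S_def T_def)
  also have "\<dots> = opcomp (opcomp a b) c n"
    by (subst comp_sum[OF bdd_comp[OF assms(1,2)] assms(3), of T]) (auto simp: T_def)
  finally show "opcomp (opcomp a b) c n = opcomp a (opcomp b c) n" by simp
qed

definition delta :: "int \<Rightarrow> 'k sdpoly \<Rightarrow> int \<Rightarrow> 'k::field_char_0 sdpoly" where
  "delta k a n = (if n = k then a else 0)"

lemma bdd_delta: "bdd k (delta k a)" by (auto simp: bdd_def delta_def)

lemma comp_delta: "opcomp (delta k a) b n = a * dpow k b n"
proof -
  have "(\<lambda>i. delta k a i * dpow i b n) = (\<lambda>i. if i = k then a * dpow k b n else 0)"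
    by (auto simp: delta_def)
  then show ?thesis by (simp only: opcomp_def Sum_any.delta)
qed

lemma dpow_delta_1: "dpow i (delta k 1) n = (delta (i + k) 1 n :: 'k::field_char_0 sdpoly)"
proof -
  have D: "(sD ^^ j) (1 :: 'k sdpoly) = 0" if "j \<noteq> 0" for j
    using that by (cases j) (auto simp: funpow_Suc_right simp del: funpow.simps)
  have "(\<lambda>j. const (sbinom i j) * (sD ^^ j) (twist (i - int j) (delta k 1 (n - i + int j))))
      = (\<lambda>j. if j = 0 then (delta (i + k) 1 n :: 'k sdpoly) else 0)"
    by (auto simp: fun_eq_iff delta_def D)
  then show ?thesis by (simp only: dpow_def Sum_any.delta)
qed

lemma comp_one: "opcomp a (delta 0 1) n = a n"
proof -
  have "(\<lambda>i. a i * dpow i (delta 0 1) n) = (\<lambda>i. if i = n then a n else 0)"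
    unfolding dpow_delta_1 by (auto simp: delta_def)
  then show ?thesis by (simp only: opcomp_def Sum_any.delta)
qed

lemma ex_bdd: "(\<exists>N. \<forall>k>N. a k = 0) \<longleftrightarrow> (\<exists>N. bdd N a)" by (simp add: bdd_def)

lemma comp_add:
  assumes "bdd M a" "bdd M a'" "bdd N b" "bdd N b'"
  shows "opcomp (\<lambda>k. a k + a' k) b n = opcomp a b n + opcomp a' b n"
    and "opcomp a (\<lambda>k. b k + b' k) n = opcomp a b n + opcomp a b' n"
proof -
  have "bdd M (\<lambda>k. a k + a' k)" "bdd N (\<lambda>k. b k + b' k)" using assms by (auto simp: bdd_def)
  then show "opcomp (\<lambda>k. a k + a' k) b n = opcomp a b n + opcomp a' b n"
    and "opcomp a (\<lambda>k. b k + b' k) n = opcomp a b n + opcomp a b' n"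
    using assms
    by (simp_all add: comp_sum[where M = M and N = N and S = "{n - N..M}"] dpow_add[of N] distrib_left distrib_right sum.distrib)
qed

instantiation spdo :: (field_char_0) ring_1
begin

lift_definition zero_spdo :: "'a spdo" is "\<lambda>n. 0" by auto
lift_definition one_spdo :: "'a spdo" is "\<lambda>n. if n = 0 then 1 else 0" by (auto intro: exI[of _ 0])
lift_definition uminus_spdo :: "'a spdo \<Rightarrow> 'a spdo" is "\<lambda>a n. - a n" by auto
lift_definition plus_spdo :: "'a spdo \<Rightarrow> 'a spdo \<Rightarrow> 'a spdo" is "\<lambda>a b n. a n + b n"
  by (metis add.right_neutral max_less_iff_conj)
lift_definition minus_spdo :: "'a spdo \<Rightarrow> 'a spdo \<Rightarrow> 'a spdo" is "\<lambda>a b n. a n - b n"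
  by (metis diff_zero max_less_iff_conj)
lift_definition times_spdo :: "'a spdo \<Rightarrow> 'a spdo \<Rightarrow> 'a spdo" is opcomp
  unfolding ex_bdd using bdd_comp by blast

instance
proof
  fix A B C :: "'a spdo"
  obtain L M N where L: "bdd L (coeff A)" and M: "bdd M (coeff B)" and N: "bdd N (coeff C)"
    using coeff[of A] coeff[of B] coeff[of C] unfolding mem_Collect_eq ex_bdd by blast
  let ?K = "max L (max M N)"
  have K: "bdd ?K (coeff A)" "bdd ?K (coeff B)" "bdd ?K (coeff C)"
    using L M N by (auto elim: bdd_mono)
  note r = plus_spdo.rep_eq times_spdo.rep_eq one_spdo.rep_eq
  have one: "coeff 1 = delta 0 (1 :: 'a sdpoly)" by (auto simp: one_spdo.rep_eq delta_def)
  show "A * B * C = A * (B * C)"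
    by (rule spdo_eqI) (simp add: r comp_assoc[OF K])
  show "(A + B) * C = A * C + B * C"
    by (rule spdo_eqI) (simp add: r comp_add(1)[OF K(1,2) K(3,3)])
  show "A * (B + C) = A * B + A * C"
    by (rule spdo_eqI) (simp add: r comp_add(2)[OF K(1,1) K(2,3)])
  show "1 * A = A"
    by (rule spdo_eqI) (simp only: times_spdo.rep_eq one comp_delta dpow_zero mult_1_left)
  show "A * 1 = A"
    by (rule spdo_eqI) (simp only: times_spdo.rep_eq one comp_one)
  show "(0 :: 'a spdo) \<noteq> 1"
    by transfer (auto simp: fun_eq_iff)
qed (transfer; simp add: fun_eq_iff)+

end

text \<open>Multiplication by \<open>a\<close>, and the \<open>k\<close>-th power of the super derivative.\<close>

definition mulop :: "'k sdpoly \<Rightarrow> 'k::field_char_0 spdo" where "mulop a = Spdo (delta 0 a)"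

definition Dop :: "int \<Rightarrow> 'k::field_char_0 spdo" where "Dop k = Spdo (delta k 1)"

lemma coeff_Spdo_delta: "coeff (Spdo (delta k a)) = delta k a"
  using bdd_delta[of k a] by (auto simp: bdd_def intro!: Spdo_inverse)

lemma coeff_mulop: "coeff (mulop a) = delta 0 a" by (simp add: mulop_def coeff_Spdo_delta)
lemma coeff_Dop: "coeff (Dop k) = delta k 1" by (simp add: Dop_def coeff_Spdo_delta)

lemma Dop_0: "Dop 0 = 1"
  by (rule spdo_eqI) (simp add: coeff_Dop one_spdo.rep_eq delta_def)

lemma Dop_mult_Dop: "Dop i * Dop j = Dop (i + j)"
  by (rule spdo_eqI) (simp add: times_spdo.rep_eq coeff_Dop comp_delta dpow_delta_1)

lemma Dop_mulop: "Dop 1 * mulop a = mulop (sD a) + mulop (twist 1 a) * Dop 1"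
proof (rule spdo_eqI)
  fix n
  have "dpow 1 (delta 0 a) n = ell (delta 0 a) n"
    using dpow_step[OF bdd_delta[of 0 a], of 0] by (simp add: dpow_zero)
  then show "coeff (Dop 1 * mulop a) n = coeff (mulop (sD a) + mulop (twist 1 a) * Dop 1) n"
    by (simp add: times_spdo.rep_eq plus_spdo.rep_eq coeff_Dop coeff_mulop comp_delta dpow_zero)
       (auto simp: ell_def delta_def)
qed

lemma coeff_mulop_Dop: "coeff (mulop a * Dop k) n = (if n = k then a else 0)"
  by (simp add: times_spdo.rep_eq coeff_Dop coeff_mulop comp_delta dpow_zero) (simp add: delta_def)

lift_definition diff_part :: "'k::field_char_0 spdo \<Rightarrow> 'k spdo" is "\<lambda>a n. if 0 \<le> n then a n else 0"
  by auto

text \<open>Meaningful whenever \<open>d 0 = 0\<close>, in particular for derivations.\<close>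

definition coeffwise :: "('k sdpoly \<Rightarrow> 'k sdpoly) \<Rightarrow> 'k spdo \<Rightarrow> 'k::field_char_0 spdo" where
  "coeffwise d A = Spdo (\<lambda>n. d (coeff A n))"

definition homog_op :: "int \<Rightarrow> 'k::field_char_0 spdo \<Rightarrow> bool" where
  "homog_op p A \<longleftrightarrow> (\<forall>k. homog (p - k) (coeff A k))"

text \<open>The supercommutator is only meant to be applied to homogeneous operators.\<close>

definition supercomm :: "'k spdo \<Rightarrow> 'k spdo \<Rightarrow> 'k::field_char_0 spdo" where
  "supercomm A B = (if homog_op 1 A \<and> homog_op 1 B then A * B + B * A else A * B - B * A)"

definition is_cube_root :: "'k spdo \<Rightarrow> 'k::field_char_0 spdo \<Rightarrow> bool" where
  "is_cube_root R A \<longleftrightarrow> homog_op 0 R \<and> coeff R 2 = 1 \<and> (\<forall>k>2. coeff R k = 0) \<and> R ^ 3 = A"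

definition cube_root :: "'k spdo \<Rightarrow> 'k::field_char_0 spdo" where
  "cube_root A = (THE R. is_cube_root R A)"

definition lax_op :: "'k::field_char_0 spdo" where
  "lax_op = (Dop 1 ^ 3 + mulop phi) * (Dop 1 ^ 3 + mulop phi)"

end

theory Submission
  imports Defs
begin

text \<open>
  The cube root \<open>R\<close> of \<open>L\<close> is never computed. Put \<open>Q = \<D>\<^sup>3 + \<phi>\<close>, so that \<open>L = Q\<^sup>2\<close>. An explicit differential
  operator \<open>P = 9 \<D>\<^sup>1\<^sup>0 + \<dots>\<close> satisfies \<open>[P, Q] = - K\<close>, where \<open>\<phi>\<^sub>t + K = 0\<close> is the Sawada-Kotera equation; hence
  \<open>[P, L] = - (Q K + K Q)\<close> has order at most 2. As \<open>R\<^sup>5\<close> commutes with \<open>L\<close>, so has \<open>[\<Delta>, L]\<close> for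
  \<open>\<Delta> = P - 9 R\<^sup>5\<close>. If \<open>\<Delta>\<close> has order \<open>k \<ge> 0\<close> and leading coefficient \<open>a\<close>, the coefficient of \<open>\<D>\<^sup>k\<^sup>+\<^sup>4\<close> in
  \<open>[\<Delta>, L]\<close> is \<open>- 3 a\<^sub>x\<close>, so \<open>a\<close> is a constant; but setting \<open>\<phi> = 0\<close> turns \<open>R\<close> into the cube root \<open>\<D>\<^sup>2\<close> of
  \<open>\<D>\<^sup>6\<close>, so \<open>\<Delta>\<close> has no constant terms. Therefore \<open>\<Delta>\<close> has negative order and \<open>9 (R\<^sup>5)\<^sub>+ = P\<close>.
  With \<open>f = \<phi>\<^sub>t + K\<close> the Lax equation becomes
  \<open>(\<D>f) \<D>\<^sup>2 - f\<^sub>x \<D> + (\<D>f\<^sub>x) = 0\<close>, that is \<open>\<D>f = 0\<close>, which forces \<open>f = 0\<close> as \<open>f\<close> has no constant term.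
\<close>

subsection \<open>Order of an operator\<close>

definition ord_le :: "int \<Rightarrow> 'k::field_char_0 spdo \<Rightarrow> bool" where
  "ord_le N A \<longleftrightarrow> bdd N (coeff A)"

lemma ord_leD: "ord_le N A \<Longrightarrow> N < k \<Longrightarrow> coeff A k = 0"
  by (simp add: ord_le_def bdd_def)

lemma ord_le_ex: "\<exists>N. ord_le N A"
  using coeff[of A] by (simp add: ord_le_def ex_bdd)

lemma ord_le_mono: "ord_le M A \<Longrightarrow> M \<le> N \<Longrightarrow> ord_le N A"
  by (auto simp: ord_le_def bdd_def)

lemma coeff_simps [simp]:
  "coeff 0 n = 0" "coeff (- A) n = - coeff A n" "coeff (A + B) n = coeff A n + coeff B n"
  "coeff (A - B) n = coeff A n - coeff B n"
  by (simp_all add: zero_spdo.rep_eq uminus_spdo.rep_eq plus_spdo.rep_eq minus_spdo.rep_eq)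

lemma coeff_diff_part: "coeff (diff_part A) n = (if 0 \<le> n then coeff A n else 0)"
  by (simp add: diff_part.rep_eq)

lemma ord_le_add: "ord_le N A \<Longrightarrow> ord_le N B \<Longrightarrow> ord_le N (A + B)"
  by (simp add: ord_le_def bdd_def)
lemma ord_le_diff: "ord_le N A \<Longrightarrow> ord_le N B \<Longrightarrow> ord_le N (A - B)"
  by (simp add: ord_le_def bdd_def)
lemma ord_le_mult: "ord_le M A \<Longrightarrow> ord_le N B \<Longrightarrow> ord_le (M + N) (A * B)"
  by (simp add: ord_le_def times_spdo.rep_eq bdd_comp)

lemma ord_le_drop: "ord_le N A \<Longrightarrow> coeff A N = 0 \<Longrightarrow> ord_le (N - 1) A"
  by (auto simp: ord_le_def bdd_def) (metis linorder_not_le nless_le zle_diff1_eq)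

text \<open>The filtration by order is separated, so identities between infinite series can be
  proved by lowering the order of the difference step by step.\<close>

lemma ord_le_all_imp_0:
  assumes "\<And>m::nat. ord_le (N - int m) A"
  shows "A = 0"
proof (rule spdo_eqI)
  fix n
  have "ord_le (N - int (nat (N - n + 1))) A" by (rule assms)
  then show "coeff A n = coeff 0 n" by (auto elim: ord_leD)
qed

text \<open>Only \<open>i = M\<close> contributes to this coefficient, and of \<D>^M applied to
  \<open>B\<close> only the term \<open>j = 0\<close>, which carries a sign twist but no
  derivative.\<close>

lemma coeff_mult_top:
  assumes "ord_le M A" "ord_le N B"
  shows "coeff (A * B) (M + N) = coeff A M * twist M (coeff B N)"
proof -
  have b: "bdd M (coeff A)" "bdd N (coeff B)" using assms by (simp_all add: ord_le_def)
  have "coeff (A * B) (M + N) = coeff A M * dpow M (coeff B) (M + N)"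
    using comp_sum[OF b, of "{M}" "M + N"] by (simp add: times_spdo.rep_eq)
  also have "dpow M (coeff B) (M + N) = twist M (coeff B N)"
    using dpow_sum[OF b(2), of "M + N" M 1] by simp
  finally show ?thesis .
qed

lemma coeff_mulop_mult: "coeff (mulop a * A) n = a * coeff A n"
  by (simp add: times_spdo.rep_eq coeff_mulop comp_delta dpow_zero)

lemma coeff_mult_Dop: "coeff (A * Dop k) n = coeff A (n - k)"
proof -
  have "(\<lambda>i. coeff A i * dpow i (delta k 1) n) = (\<lambda>i. if i = n - k then coeff A (n - k) else 0)"
    by (auto simp: dpow_delta_1 delta_def)
  then show ?thesis by (simp only: times_spdo.rep_eq coeff_Dop opcomp_def Sum_any.delta)
qed

lemma ord_le_mulop_Dop: "ord_le k (mulop a * Dop k)"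
  by (simp add: ord_le_def bdd_def coeff_mulop_Dop)

lemma ord_le_Dop: "ord_le k (Dop k)"
  by (simp add: ord_le_def coeff_Dop bdd_delta)

section \<open>Monic operators and uniqueness of the cube root\<close>

definition monic :: "int \<Rightarrow> 'k::field_char_0 spdo \<Rightarrow> bool" where
  "monic N A \<longleftrightarrow> ord_le N A \<and> coeff A N = 1"

lemma monic_mult: "monic M A \<Longrightarrow> monic N B \<Longrightarrow> monic (M + N) (A * B)"
  by (simp add: monic_def ord_le_mult coeff_mult_top)

lemma monic_Dop: "monic k (Dop k)"
  by (simp add: monic_def ord_le_Dop coeff_Dop delta_def)

lemma const_numeral: "const (numeral v) = numeral v"
  by (induction v) (simp_all only: numeral.simps const_add const_1)

lemma three_mult_eq_0:
  fixes a :: "'k::field_char_0 sdpoly"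
  assumes "a + a + a = 0"
  shows "a = 0"
proof -
  have "const (1 / 3 + 1 / 3 + 1 / 3) * a = const (1 / 3) * (a + a + a)"
    by (simp only: const_add distrib_left distrib_right)
  then show ?thesis using assms by simp
qed

lemma third_sum: "const (1 / 3) * a + const (1 / 3) * a + const (1 / 3) * a = (a :: 'k::field_char_0 sdpoly)"
  by (simp flip: const_add distrib_right)

text \<open>As \<open>A\<close> and \<open>B\<close> are monic of even order, each product keeps the
  top coefficient of \<open>C\<close> without a sign. With \<open>C = A - B\<close> the sum is
  \<open>A ^ 3 - B ^ 3\<close>, by \<open>cube_diff\<close>.\<close>

lemma ord_le_sandwich:
  assumes A: "monic 2 A" and B: "monic 2 B" and C: "ord_le N C"
  shows "ord_le (N + 4) (A * A * C + A * C * B + C * B * B)"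
    and "coeff (A * A * C + A * C * B + C * B * B) (N + 4) = coeff C N + coeff C N + coeff C N"
proof -
  have AA: "monic 4 (A * A)" using monic_mult[OF A A] by simp
  have BB: "monic 4 (B * B)" using monic_mult[OF B B] by simp
  have CB: "ord_le (N + 2) (C * B)" "coeff (C * B) (N + 2) = coeff C N"
    using C B ord_le_mult[of N C 2 B] coeff_mult_top[of N C 2 B] by (simp_all add: monic_def)
  have 1: "ord_le (N + 4) (A * A * C)" "coeff (A * A * C) (N + 4) = coeff C N"
    using AA C ord_le_mult[of 4 "A * A" N C] coeff_mult_top[of 4 "A * A" N C]
    by (simp_all add: monic_def twist_even add.commute)
  have 2: "ord_le (N + 4) (A * C * B)" "coeff (A * C * B) (N + 4) = coeff C N"
    using A CB ord_le_mult[of 2 A "N + 2" "C * B"] coeff_mult_top[of 2 A "N + 2" "C * B"]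
    by (simp_all add: monic_def twist_even add.commute mult.assoc)
  have 3: "ord_le (N + 4) (C * B * B)" "coeff (C * B * B) (N + 4) = coeff C N"
    using BB C ord_le_mult[of N C 4 "B * B"] coeff_mult_top[of N C 4 "B * B"]
    by (simp_all add: monic_def mult.assoc)
  show "ord_le (N + 4) (A * A * C + A * C * B + C * B * B)"
    using 1 2 3 by (intro ord_le_add)
  show "coeff (A * A * C + A * C * B + C * B * B) (N + 4) = coeff C N + coeff C N + coeff C N"
    using 1 2 3 by simp
qed

text \<open>Three times the top coefficient of \<open>C\<close> vanishes, hence so does the
  coefficient; this repeats at every lower order.\<close>

lemma sandwich_eq_0:
  assumes A: "monic 2 A" and B: "monic 2 B" and eq: "A * A * C + A * C * B + C * B * B = 0"
  shows "C = 0"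
proof -
  obtain N where N: "ord_le N C" using ord_le_ex by blast
  have "ord_le (N - int m) C" for m
  proof (induction m)
    case (Suc m)
    have "coeff C (N - int m) = 0"
      by (rule three_mult_eq_0) (metis ord_le_sandwich(2)[OF A B Suc] eq coeff_simps(1))
    from ord_le_drop[OF Suc this] show ?case by (simp add: algebra_simps)
  qed (simp add: N)
  then show ?thesis by (rule ord_le_all_imp_0)
qed

text \<open>Since \<open>A\<close> and \<open>B\<close> need not commute, the three factors are
  exchanged one at a time.\<close>

lemma cube_diff: "A ^ 3 - B ^ 3 = A * A * (A - B) + A * (A - B) * B + (A - B) * B * B"
  for A B :: "'a::ring_1"
  by (simp add: power3_eq_cube algebra_simps)

lemma cube_inj: "monic 2 A \<Longrightarrow> monic 2 B \<Longrightarrow> A ^ 3 = B ^ 3 \<Longrightarrow> A = B"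
  using sandwich_eq_0[of A B "A - B"] cube_diff[of A B] by simp


subsection \<open>Existence of the cube root\<close>

lemma homog_twist: "homog p a \<Longrightarrow> homog p (twist q a)"
  by (simp add: twist_homog homog_sgp)

lemma homog_sD_funpow: "homog p a \<Longrightarrow> homog (p + int j) ((sD ^^ j) a)"
proof (induction j)
  case (Suc j)
  then show ?case using homog_sD[OF Suc.IH[OF Suc.prems]] by (simp add: algebra_simps)
qed simp

lemma homog_const_mult: "homog p a \<Longrightarrow> homog p (const c * a)"
  using homog_mult[of 0 "const c" p a] homog_const[of 0 c] by simp

text \<open>In the \<open>j\<close>-th term the \<open>j\<close> derivatives raise the parity by
  \<open>j\<close>, which cancels the shift of the index by \<open>j\<close>; so all terms have
  equal parity.\<close>

lemma homog_dpow:
  assumes "bdd N b" "\<And>k. homog (q - k) (b k)"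
  shows "homog (q + i - n) (dpow i b n)"
proof -
  have "N < n - i + int (nat (N - n + i + 1))" by simp
  note dpow_sum[OF assms(1) this]
  moreover have "homog (q + i - n) (const (sbinom i j) * (sD ^^ j) (twist (i - int j) (b (n - i + int j))))" for j
    using homog_sD_funpow[OF homog_twist[OF assms(2)[of "n - i + int j"]], of j "i - int j"]
    by (intro homog_const_mult) (simp add: algebra_simps)
  ultimately show ?thesis by (simp add: homog_sum)
qed

lemma homog_op_mult:
  assumes "homog_op p A" "homog_op q B"
  shows "homog_op (p + q) (A * B)"
  unfolding homog_op_def
proof
  fix n
  obtain M N where b: "bdd M (coeff A)" "bdd N (coeff B)"
    using ord_le_ex[of A] ord_le_ex[of B] unfolding ord_le_def by blast
  have "coeff (A * B) n = (\<Sum>i\<in>{n - N..M}. coeff A i * dpow i (coeff B) n)"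
    using comp_sum[OF b, of "{n - N..M}" n] by (simp add: times_spdo.rep_eq)
  moreover have "homog (p + q - n) (coeff A i * dpow i (coeff B) n)" for i
    using homog_mult[OF assms(1)[unfolded homog_op_def, rule_format, of i]
        homog_dpow[OF b(2) assms(2)[unfolded homog_op_def, rule_format], of i n]]
    by (simp add: algebra_simps)
  ultimately show "homog (p + q - n) (coeff (A * B) n)" by (simp add: homog_sum)
qed

lemma homog_op_add: "homog_op p A \<Longrightarrow> homog_op p B \<Longrightarrow> homog_op p (A + B)"
  by (simp add: homog_op_def homog_add)
lemma homog_op_uminus: "homog_op p A \<Longrightarrow> homog_op p (- A)"
  by (simp add: homog_op_def homog_uminus)
lemma homog_op_diff: "homog_op p A \<Longrightarrow> homog_op p B \<Longrightarrow> homog_op p (A - B)"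
  using homog_op_add[of p A "- B"] homog_op_uminus[of p B] by simp
lemma homog_op_cong: "homog_op p A \<Longrightarrow> even (p - q) \<Longrightarrow> homog_op q A"
  unfolding homog_op_def by (auto intro: homog_cong)

lemma homog_1: "even p \<Longrightarrow> homog p 1"
  using homog_const[of p 1] by simp

lemma homog_op_Dop: "even (p - k) \<Longrightarrow> homog_op p (Dop k)"
  by (simp add: homog_op_def coeff_Dop delta_def homog_1)
lemma homog_op_mulop_Dop: "homog (p - k) a \<Longrightarrow> homog_op p (mulop a * Dop k)"
  by (simp add: homog_op_def coeff_mulop_Dop)

text \<open>Adding \<open>E\<close> of order \<open>k\<close> changes the coefficient of \<open>\<D>\<^sup>k\<^sup>+\<^sup>4\<close> in the cube by three times the top
  coefficient of \<open>E\<close>.\<close>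

fun root_approx :: "'k::field_char_0 spdo \<Rightarrow> nat \<Rightarrow> 'k spdo" where
  "root_approx A 0 = Dop 2"
| "root_approx A (Suc m) = root_approx A m
     + mulop (const (1 / 3) * coeff (A - root_approx A m ^ 3) (5 - int m)) * Dop (1 - int m)"

context
  fixes A :: "'k::field_char_0 spdo"
  assumes monic: "monic 6 A" and homog: "homog_op 0 A"
begin

lemma root_approx_monic: "monic 2 (root_approx A m)"
proof (induction m)
  case (Suc m)
  have "ord_le 1 (root_approx A (Suc m) - root_approx A m)"
    by (simp add: ord_le_mono[OF ord_le_mulop_Dop])
  then have "ord_le 1 (mulop (const (1 / 3) * coeff (A - root_approx A m ^ 3) (5 - int m)) * Dop (1 - int m))"
    by simp
  then show ?case using Suc
    by (auto simp: monic_def intro!: ord_le_add elim: ord_le_mono dest: ord_leD[where k = 2])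
qed (simp add: monic_Dop)

lemma root_approx_homog: "homog_op 0 (root_approx A m)"
proof (induction m)
  case (Suc m)
  have "homog_op 0 (root_approx A m ^ 3)"
    using homog_op_mult[OF homog_op_mult[OF Suc Suc] Suc] by (simp add: power3_eq_cube)
  then have "homog_op 0 (A - root_approx A m ^ 3)" by (intro homog_op_diff homog)
  then have "homog (0 - (5 - int m)) (coeff (A - root_approx A m ^ 3) (5 - int m))"
    unfolding homog_op_def by (rule spec)
  \<comment> \<open>The two indices differ by 4, so the correction has the parity that its power of
    \<D> requires.\<close>
  then have "homog (0 - (1 - int m)) (coeff (A - root_approx A m ^ 3) (5 - int m))"
    by (rule homog_cong) simp
  then show ?case
    unfolding root_approx.simps by (intro homog_op_add Suc homog_op_mulop_Dop homog_const_mult)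
qed (simp add: homog_op_Dop)

lemma root_approx_cube: "ord_le (5 - int m) (A - root_approx A m ^ 3)"
proof (induction m)
  case 0
  have "monic 6 (Dop 2 ^ 3 :: 'k spdo)"
    using monic_Dop[of 6] by (simp add: power3_eq_cube Dop_mult_Dop)
  with monic have "ord_le 6 (A - Dop 2 ^ 3)" "coeff (A - Dop 2 ^ 3) 6 = 0"
    by (simp_all add: monic_def ord_le_diff)
  from ord_le_drop[OF this] show ?case by simp
next
  case (Suc m)
  define R R' where "R = root_approx A m" and "R' = root_approx A (Suc m)"
  define E where "E = mulop (const (1 / 3) * coeff (A - R ^ 3) (5 - int m)) * Dop (1 - int m)"
  define X where "X = A - R ^ 3"
  have R': "R' = R + E" by (simp add: R_def R'_def E_def)
  have E: "ord_le (1 - int m) E" "coeff E (1 - int m) = const (1 / 3) * coeff X (5 - int m)"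
    by (simp_all add: E_def X_def ord_le_mulop_Dop coeff_mulop_Dop)
  have m: "monic 2 R" "monic 2 R'" by (simp_all add: R_def R'_def root_approx_monic del: root_approx.simps)
  define S where "S = R' * R' * E + R' * E * R + E * R * R"
  have S: "ord_le (5 - int m) S" "coeff S (5 - int m) = coeff X (5 - int m)"
    using ord_le_sandwich[OF m(2,1) E(1)] by (simp_all add: S_def E(2) third_sum)
  \<comment> \<open>\<open>S\<close> is the change of the cube; the factor 1/3 in \<open>E\<close>
    makes its top coefficient equal to that of the error \<open>X\<close>.\<close>
  have "A - R' ^ 3 = X - S" using cube_diff[of R' R] by (simp add: R' X_def S_def algebra_simps)
  moreover have "ord_le (5 - int m) (X - S)" using Suc S by (simp add: X_def R_def ord_le_diff)
  moreover have "coeff (X - S) (5 - int m) = 0" using S by simp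
  ultimately have "ord_le (5 - int m - 1) (A - R' ^ 3)" by (metis ord_le_drop)
  then show ?case by (simp add: R'_def algebra_simps del: root_approx.simps)
qed

text \<open>Corrections made from stage \<open>m\<close> on have order at most \<open>1 - m\<close>,
  so every coefficient is eventually constant.\<close>

lemma root_approx_stable: "m \<le> m' \<Longrightarrow> 1 - int m < k \<Longrightarrow> coeff (root_approx A m') k = coeff (root_approx A m) k"
proof (induction m' rule: dec_induct)
  case (step m')
  then show ?case by (simp add: coeff_mulop_Dop)
qed simp

lemma ex_cube_root: "\<exists>R. is_cube_root R A"
proof -
  \<comment> \<open>Stage \<open>2 - k\<close> is the first at which
    \<open>root_approx_stable\<close> makes the coefficient of \<D>^k final.\<close>
  define r where "r k = (if k \<le> 2 then coeff (root_approx A (nat (2 - k))) k else 0)" for k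
  define R where "R = Spdo r"
  have R: "coeff R = r" unfolding R_def by (rule Spdo_inverse) (auto simp: r_def intro: exI[of _ 2])
  have mR: "monic 2 R"
    using root_approx_monic[of 0] by (simp add: monic_def ord_le_def bdd_def R r_def)
  have app: "ord_le (1 - int m) (root_approx A m - R)" for m
    unfolding ord_le_def bdd_def
  proof (intro allI impI)
    fix k assume k: "1 - int m < k"
    show "coeff (root_approx A m - R) k = 0"
    proof (cases "k \<le> 2")
      case True
      then show ?thesis using k root_approx_stable[of "nat (2 - k)" m k] by (simp add: R r_def)
    next
      case False
      then show ?thesis using root_approx_monic[of m] by (auto simp: R r_def monic_def elim: ord_leD)
    qed
  qed
  have "R ^ 3 = A"
  proof -
    have "ord_le (5 - int m) (A - R ^ 3)" for m
    proof -
      have "ord_le (1 - int m + 4) (root_approx A m ^ 3 - R ^ 3)"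
        unfolding cube_diff by (rule ord_le_sandwich(1)[OF root_approx_monic mR app])
      then have "ord_le (5 - int m) (root_approx A m ^ 3 - R ^ 3)" by (simp add: algebra_simps)
      from ord_le_add[OF root_approx_cube[of m] this] show ?thesis by simp
    qed
    from ord_le_all_imp_0[OF this] show ?thesis by simp
  qed
  moreover have "homog_op 0 R"
    using root_approx_homog by (auto simp: homog_op_def R r_def)
  ultimately show ?thesis
    using mR by (auto simp: is_cube_root_def monic_def dest: ord_leD)
qed

lemma is_cube_root_cube_root: "is_cube_root (cube_root A) A"
proof -
  obtain R where R: "is_cube_root R A" using ex_cube_root ..
  have m: "monic 2 S" "S ^ 3 = A" if "is_cube_root S A" for S
    using that by (simp_all add: is_cube_root_def monic_def ord_le_def bdd_def)
  have uniq: "S = R" if "is_cube_root S A" for S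
    by (rule cube_inj) (simp_all only: m[OF that] m[OF R])
  show ?thesis unfolding cube_root_def by (rule theI[of "\<lambda>S. is_cube_root S A", OF R uniq])
qed

end


subsection \<open>The kernel of the even derivative\<close>

lemma const_term_simps [simp]:
  "const_term 0 = 0" "const_term 1 = 1" "const_term (a + b) = const_term a + const_term b"
  "const_term (a - b) = const_term a - const_term b" "const_term (- a) = - const_term a"
  "const_term (a * b) = const_term a * const_term b" "const_term (const c) = c" "const_term (gen k) = 0"
proof -
  show "const_term 0 = 0" by transfer simp
  show "const_term 1 = 1" by transfer (simp add: lookup_one)
  show "const_term (a + b) = const_term a + const_term b" by transfer (simp add: lookup_add)
  show "const_term (a - b) = const_term a - const_term b" by transfer (simp add: lookup_minus)
  show "const_term (- a) = - const_term a" by transfer simp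
  show "const_term (a * b) = const_term a * const_term b" by transfer (rule lookup_mult_0)
  show "const_term (const c) = c" by transfer simp
  show "const_term (gen k) = 0" by transfer (simp add: zero_word_def lookup_single)
qed

text \<open>The partial derivative by \<open>gen k\<close>, a superderivation with the parity of
  \<open>gen k\<close>.\<close>

definition pder :: "nat \<Rightarrow> 'k sdpoly \<Rightarrow> 'k::field_char_0 sdpoly" where
  "pder k = sder (int k + 1) (\<lambda>j. if j = k then 1 else 0)"

lemma homog_pder_gen: "homog (int j + 1 + (int k + 1)) (if j = k then 1 else 0)"
  using homog_const[of "int k + 1 + (int k + 1)" 1] by (cases "j = k") simp_all

lemma pder_add: "pder k (a + b) = pder k a + pder k b"
  unfolding pder_def by (rule sder_add[OF homog_pder_gen])
lemma pder_mult: "pder k (a * b) = pder k a * b + twist (int k + 1) a * pder k b"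
  unfolding pder_def by (rule sder_mult[OF homog_pder_gen])
lemma pder_const: "pder k (const c) = 0"
  unfolding pder_def by (rule sder_const[OF homog_pder_gen])
lemma pder_gen: "pder k (gen j) = (if j = k then 1 else 0)"
  unfolding pder_def by (rule sder_gen[OF homog_pder_gen])

lemma dx_add: "dx (a + b) = dx a + dx b"
  by (simp add: dx_def sD_add)
text \<open>The mixed terms cancel because \<open>sD\<close> anticommutes with the sign
  twist.\<close>

lemma dx_mult: "dx (a * b) = dx a * b + a * dx b"
  by (simp add: dx_def sD_mult sD_add sD_twist twist_twist twist_even sgp_def algebra_simps)
lemma dx_const: "dx (const c) = 0"
  by (simp add: dx_def sD_const)
lemma dx_gen: "dx (gen k) = gen (k + 2)"
  by (simp add: dx_def sD_gen)
lemma dx_0 [simp]: "dx 0 = 0"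
  by (simp add: dx_def)
lemma dx_1 [simp]: "dx 1 = 0"
  by (simp add: dx_def)
lemma dx_twist: "dx (twist p a) = twist p (dx a)"
  by (simp add: dx_def sD_twist sD_sgp_mult flip: mult.assoc)

text \<open>\<open>dx\<close> raises the index of a generator by 2, so its commutator with one
  partial derivative is the partial derivative two indices below.\<close>

lemma pder_dx: "pder (Suc (Suc k)) (dx a) = dx (pder (Suc (Suc k)) a) + pder k a"
proof (induction a rule: sdpoly_induct)
  case (mult a b)
  have "twist (int (Suc (Suc k)) + 1) x = twist (int k + 1) x" for x :: "'a sdpoly"
    by (rule twist_cong) simp
  then show ?case
    by (simp add: dx_mult pder_mult dx_add pder_add mult dx_twist algebra_simps)
qed (auto simp: dx_const pder_const dx_gen pder_gen dx_add pder_add pder_const[of _ 0, simplified])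

lemma pder_finite: "\<exists>n. \<forall>k\<ge>n. pder k a = 0"
proof (induction a rule: sdpoly_induct)
  case (gen j)
  show ?case by (rule exI[of _ "Suc j"]) (auto simp: pder_gen)
next
  case (add a b)
  then obtain m n where "\<forall>k\<ge>m. pder k a = 0" "\<forall>k\<ge>n. pder k b = 0" by blast
  then show ?case by (intro exI[of _ "max m n"]) (auto simp: pder_add)
next
  case (mult a b)
  then obtain m n where "\<forall>k\<ge>m. pder k a = 0" "\<forall>k\<ge>n. pder k b = 0" by blast
  then show ?case by (intro exI[of _ "max m n"]) (auto simp: pder_mult)
qed (simp add: pder_const)

text \<open>By \<open>pder_dx\<close>, vanishing at \<open>k + 2\<close> implies vanishing at
  \<open>k\<close>. The descent starts at a generator that does not occur in
  \<open>a\<close>.\<close>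

lemma pder_eq_0:
  assumes "dx a = 0"
  shows "pder k a = 0"
proof -
  obtain n where n: "\<forall>k\<ge>n. pder k a = 0" using pder_finite by blast
  have *: "pder k a = 0" if "pder (Suc (Suc k)) a = 0" for k
    using pder_dx[of k a] that by (simp add: assms pder_const[of _ 0, simplified])
  have "pder (k + 2 * n) a = 0" using n by simp
  then have "pder (k + 2 * (n - m)) a = 0" if "m \<le> n" for m
    using that
  proof (induction m)
    case (Suc m)
    then have "Suc (Suc (k + 2 * (n - Suc m))) = k + 2 * (n - m)" by simp
    with Suc show ?case by (metis * Suc_leD)
  qed simp
  from this[of n] show ?thesis by simp
qed

section \<open>The Euler operator, which multiplies a word by its length\<close>

definition euler :: "'k sdpoly \<Rightarrow> 'k::field_char_0 sdpoly" where
  "euler = sder 0 gen"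

lemma homog_gen_euler: "homog (int k + 1 + 0) (gen k)" by (rule homog_gen) simp

lemma euler_add: "euler (a + b) = euler a + euler b"
  unfolding euler_def by (rule sder_add[OF homog_gen_euler])
lemma euler_mult: "euler (a * b) = euler a * b + a * euler b"
  using sder_mult[OF homog_gen_euler, of a b] by (simp add: euler_def twist_even)
lemma euler_const: "euler (const c) = 0"
  unfolding euler_def by (rule sder_const[OF homog_gen_euler])
lemma euler_gen: "euler (gen k) = gen k"
  unfolding euler_def by (rule sder_gen[OF homog_gen_euler])
lemma euler_0: "euler 0 = 0"
  using euler_const[of 0] by simp
lemma euler_sum: "euler (sum f S) = (\<Sum>i\<in>S. euler (f i))"
  by (induction S rule: infinite_finite_induct) (auto simp: euler_add euler_0)

text \<open>Supercommutativity for elements of mixed parity: the twist supplies the sign monomial by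
  monomial.\<close>

lemma gen_twist: "gen k * twist (int k + 1) a = a * gen k"
proof (induction a rule: sdpoly_induct)
  case (const c)
  show ?case by (simp add: const_central)
next
  case (gen j)
  have "gen k * twist (int k + 1) (gen j) = sgp ((int k + 1) * (int j + 1)) * (gen k * gen j :: 'a sdpoly)"
    by (simp only: twist_gen sgp_lc)
  also have "\<dots> = gen j * gen k"
    unfolding gen_commute[of k j] mult.assoc[symmetric] sgp_square by simp
  finally show ?case .
next
  case (add a b)
  then show ?case by (simp add: twist_add algebra_simps)
next
  case (mult a b)
  then show ?case by (simp add: twist_mult) (metis mult.assoc)
qed

text \<open>Euler's identity: both sides are even derivations that agree on generators. Allowing
  every \<open>m \<ge> n\<close> lets the bounds for two elements be merged.\<close>

lemma euler_eq_sum_pder: "\<exists>n. \<forall>m\<ge>n. euler a = (\<Sum>k<m. gen k * pder k a)"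
proof (induction a rule: sdpoly_induct)
  case (gen j)
  have "(\<Sum>k<m. gen k * pder k (gen j)) = gen j" if "Suc j \<le> m" for m
    using that by (simp add: pder_gen if_distrib[of "\<lambda>x. _ * x"] cong: if_cong)
  then show ?case by (metis euler_gen)
next
  case (add a b)
  then obtain m n where *: "\<forall>m'\<ge>m. euler a = (\<Sum>k<m'. gen k * pder k a)"
    "\<forall>m'\<ge>n. euler b = (\<Sum>k<m'. gen k * pder k b)" by blast
  have "euler (a + b) = (\<Sum>k<l. gen k * pder k (a + b))" if "max m n \<le> l" for l
  proof -
    have "euler a = (\<Sum>k<l. gen k * pder k a)" "euler b = (\<Sum>k<l. gen k * pder k b)"
      using * that by auto
    then show ?thesis by (simp only: euler_add pder_add distrib_left sum.distrib)
  qed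
  then show ?case by blast
next
  case (mult a b)
  then obtain m n where *: "\<forall>m'\<ge>m. euler a = (\<Sum>k<m'. gen k * pder k a)"
    "\<forall>m'\<ge>n. euler b = (\<Sum>k<m'. gen k * pder k b)" by blast
  have "euler (a * b) = (\<Sum>k<l. gen k * pder k (a * b))" if "max m n \<le> l" for l
  proof -
    have "gen k * pder k (a * b) = gen k * pder k a * b + a * (gen k * pder k b)" for k
      by (simp add: pder_mult distrib_left) (metis gen_twist mult.assoc)
    moreover have "euler a = (\<Sum>k<l. gen k * pder k a)" "euler b = (\<Sum>k<l. gen k * pder k b)"
      using * that by auto
    ultimately show ?thesis
      by (simp add: euler_mult sum.distrib sum_distrib_left sum_distrib_right)
  qed
  then show ?case by blast
qed (auto simp: euler_const pder_const)

lemma euler_word: "euler (abs_sdpoly (single (Word u) 1)) = const (of_nat (length u)) * abs_sdpoly (single (Word u) (1::'k::field_char_0))"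
proof (induction u)
  case Nil
  show ?case using euler_const[of 1] by (simp add: abs_Nil)
next
  case (Cons k u)
  then show ?case
    by (simp add: abs_Cons euler_mult euler_gen const_add const_lc distrib_right)
qed

text \<open>Grading by word length: \<open>f i\<close> is the component of degree
  \<open>i + 1\<close>. Allowing every \<open>N \<ge> n\<close> lets decompositions of different
  lengths be added.\<close>

lemma euler_decomp:
  "\<exists>c f n. (\<forall>i. euler (f i) = const (of_nat (Suc i)) * f i) \<and> (\<forall>N\<ge>n. a = const c + (\<Sum>i<N. f i))"
    (is "?P a")
proof -
  have "?P (abs_sdpoly h)" for h :: "word \<Rightarrow>\<^sub>0 'a"
  proof (induction h rule: pm_induct)
    case (single w c)
    define a where "a = const c * abs_sdpoly (single w 1)"
    define l where "l = length (letters w)"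
    have e: "euler a = const (of_nat l) * a"
      using euler_word[of "letters w", where ?'k = 'a]
      by (simp add: a_def l_def euler_mult euler_const const_lc[of "const c" "of_nat _"])
    have "?P a"
    proof (cases l)
      case 0
      then have "w = Word []" unfolding l_def by (cases w) simp
      then have "a = const c" by (simp add: a_def abs_Nil)
      then show ?thesis
        by (intro exI[of _ c] exI[of _ "\<lambda>_. 0"]) (simp add: euler_0)
    next
      case (Suc j)
      have "a = (\<Sum>i<N. if i = j then a else 0)" if "Suc j \<le> N" for N
        using that by simp
      then show ?thesis using e Suc
        by (intro exI[of _ 0] exI[of _ "\<lambda>i. if i = j then a else 0"] exI[of _ "Suc j"])
           (simp add: euler_0)
    qed
    then show ?case by (simp only: a_def abs_single[of w c])
  next
    case (add g h)
    then obtain c f m d f' n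
      where *: "\<forall>i. euler (f i) = const (of_nat (Suc i)) * f i" "\<forall>i. euler (f' i) = const (of_nat (Suc i)) * f' i"
        "\<forall>N\<ge>m. abs_sdpoly g = const c + (\<Sum>i<N. f i)" "\<forall>N\<ge>n. abs_sdpoly h = const d + (\<Sum>i<N. f' i)"
      by blast
    have "abs_sdpoly (g + h) = const (c + d) + (\<Sum>i<N. f i + f' i)" if "max m n \<le> N" for N
    proof -
      have "abs_sdpoly g = const c + (\<Sum>i<N. f i)" "abs_sdpoly h = const d + (\<Sum>i<N. f' i)"
        using that *(3,4) by auto
      then show ?thesis by (simp only: abs_add sum.distrib const_add ac_simps)
    qed
    moreover have "euler (f i + f' i) = const (of_nat (Suc i)) * (f i + f' i)" for i
      using *(1,2) by (simp add: euler_add distrib_left)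
    ultimately show ?case
      by (intro exI[of _ "c + d"] exI[of _ "\<lambda>i. f i + f' i"] exI[of _ "max m n"]) simp
  qed
  from this[of "rep_sdpoly a"] show ?thesis by (simp only: abs_rep)
qed

text \<open>The step multiplies by \<open>1 - E/n\<close>, with \<open>E\<close> the Euler operator: this fixes \<open>a\<close> and \<open>c\<close> and kills the
  component of degree \<open>n\<close>.\<close>

lemma euler_kernel:
  assumes "euler a = 0" "a = const c + (\<Sum>i<n. f i)" "\<And>i. euler (f i) = const (of_nat (Suc i)) * f i"
  shows "a = const c"
  using assms(2,3)
proof (induction n arbitrary: f)
  case (Suc n)
  define r :: "'a" where "r = 1 / of_nat (Suc n)"
  define g where "g i = const (1 - r * of_nat (Suc i)) * f i" for i
  have *: "x - const (1 - y) * x = const y * x" for x :: "'a sdpoly" and y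
  proof -
    have "const (1 - y) * x + const y * x = x"
      by (simp flip: distrib_right const_add)
    then show ?thesis by (simp add: algebra_simps)
  qed
  have r: "const r * (const (of_nat (Suc i)) * f i) = f i - g i" for i
    by (simp only: g_def * const_mult mult.assoc)
  have gn: "g n = 0" by (simp add: g_def r_def del: of_nat_Suc)
  have "0 = const r * euler a" using assms(1) by simp
  also have "\<dots> = (\<Sum>i<Suc n. const r * euler (f i))"
    unfolding Suc.prems(1) by (simp only: euler_add euler_const euler_sum sum_distrib_left add_0_left)
  also have "\<dots> = (\<Sum>i<Suc n. f i - g i)" by (simp only: Suc.prems(2) r)
  also have "\<dots> = (\<Sum>i<Suc n. f i) - (\<Sum>i<n. g i)" using gn by (simp add: sum_subtractf)
  finally have "a = const c + (\<Sum>i<n. g i)" using Suc.prems(1) by simp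
  moreover have "euler (g i) = const (of_nat (Suc i)) * g i" for i
    using Suc.prems(2)[of i] by (simp only: g_def euler_mult euler_const const_lc[of "const _" "of_nat (Suc i)"] mult_zero_left add_0_left)
  ultimately show ?case by (rule Suc.IH)
qed simp

text \<open>All partial derivatives of \<open>a\<close> vanish, hence so does
  \<open>euler a\<close>, and in characteristic 0 the Euler operator kills only constants.\<close>

lemma dx_eq_0:
  assumes "dx a = 0"
  shows "a = const (const_term a)"
proof -
  have "euler a = 0"
    using euler_eq_sum_pder[of a] by (auto simp: pder_eq_0[OF assms])
  moreover obtain c f n where "\<forall>i. euler (f i) = const (of_nat (Suc i)) * f i" "a = const c + (\<Sum>i<n. f i)"
    using euler_decomp[of a] by blast
  ultimately have "a = const c" by (intro euler_kernel) auto
  then show ?thesis by simp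
qed

lemma sD_eq_0: "sD a = 0 \<Longrightarrow> const_term a = 0 \<Longrightarrow> a = 0"
  using dx_eq_0[of a] by (simp add: dx_def)


subsection \<open>Constant terms\<close>

lemma const_term_sum: "const_term (sum f S) = (\<Sum>i\<in>S. const_term (f i))"
  by (induction S rule: infinite_finite_induct) simp_all

lemma const_term_twist [simp]: "const_term (twist p a) = const_term a"
  by (induction a rule: sdpoly_induct) (simp_all add: twist_gen twist_add twist_mult sgp_def)

lemma const_term_sD [simp]: "const_term (sD a) = 0"
  by (induction a rule: sdpoly_induct) (simp_all add: sD_const sD_gen sD_add sD_mult)

lemma const_term_dx [simp]: "const_term (dx a) = 0"
  by (simp add: dx_def)

text \<open>The substitution \<open>\<phi> = 0\<close>, a ring homomorphism because \<open>\<D>\<close> kills constants.\<close>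

definition aug :: "'k spdo \<Rightarrow> 'k::field_char_0 spdo" where
  "aug A = Spdo (\<lambda>n. const (const_term (coeff A n)))"

lemma coeff_aug: "coeff (aug A) n = const (const_term (coeff A n))"
proof -
  obtain N where "ord_le N A" using ord_le_ex by blast
  then have "coeff (aug A) = (\<lambda>n. const (const_term (coeff A n)))"
    unfolding aug_def by (intro Spdo_inverse) (auto simp: ord_leD intro!: exI[of _ N])
  then show ?thesis by simp
qed

lemma ord_le_aug: "ord_le N A \<Longrightarrow> ord_le N (aug A)"
  by (simp add: ord_le_def bdd_def coeff_aug)

lemma monic_aug: "monic N A \<Longrightarrow> monic N (aug A)"
  by (simp add: monic_def ord_le_aug coeff_aug)

lemma const_term_sD_funpow: "const_term ((sD ^^ j) a) = (if j = 0 then const_term a else 0)"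
  by (cases j) simp_all

lemma const_term_dpow:
  assumes "bdd N b"
  shows "const_term (dpow i b n) = const_term (b (n - i))"
proof -
  define J where "J = Suc (nat (N - n + i + 1))"
  have "N < n - i + int J" by (simp add: J_def)
  then have "const_term (dpow i b n) = (\<Sum>j<J. if j = 0 then const_term (b (n - i)) else 0)"
    unfolding dpow_sum[OF assms \<open>N < n - i + int J\<close>] const_term_sum
    by (intro sum.cong) (simp_all add: const_term_sD_funpow)
  then show ?thesis by (simp add: J_def)
qed

lemma sD_funpow_const: "(sD ^^ j) (const c) = (if j = 0 then const c else 0)"
  by (induction j) (simp_all add: sD_const)

lemma dpow_const: "dpow i (\<lambda>k. const (f k)) n = const (f (n - i))"
proof -
  have "(\<lambda>j. const (sbinom i j) * (sD ^^ j) (twist (i - int j) (const (f (n - i + int j)))))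
      = (\<lambda>j. if j = 0 then const (f (n - i)) else 0)"
    by (auto simp: fun_eq_iff sD_funpow_const)
  then show ?thesis by (simp only: dpow_def Sum_any.delta)
qed

lemma const_sum: "const (sum f S) = (\<Sum>i\<in>S. const (f i))"
  by (induction S rule: infinite_finite_induct) (simp_all add: const_add)

lemma aug_mult: "aug (A * B) = aug A * aug B"
proof (rule spdo_eqI)
  fix n
  obtain M N where o: "ord_le M A" "ord_le N B" using ord_le_ex by blast
  note b = o[unfolded ord_le_def] and b' = o[THEN ord_le_aug, unfolded ord_le_def]
  have B': "coeff (aug B) = (\<lambda>k. const (const_term (coeff B k)))" by (simp add: coeff_aug fun_eq_iff)
  show "coeff (aug (A * B)) n = coeff (aug A * aug B) n"
    unfolding coeff_aug[of "A * B"] times_spdo.rep_eq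
    using comp_sum[OF b, of "{n - N..M}" n] comp_sum[OF b', of "{n - N..M}" n]
    by (simp add: const_term_sum const_sum const_term_dpow[OF b(2)] const_mult B' dpow_const) (simp add: coeff_aug)
qed

lemma aug_power: "aug (A ^ n) = aug A ^ n"
proof (induction n)
  case 0
  show ?case by (rule spdo_eqI) (simp add: coeff_aug one_spdo.rep_eq)
qed (simp add: aug_mult)

subsection \<open>The commutator\<close>

lemma Dop_power: "Dop i ^ n = Dop (int n * i)"
  by (induction n) (simp_all add: Dop_0 Dop_mult_Dop algebra_simps)

lemma mulop_mult: "mulop a * mulop b = mulop (a * b)"
  by (rule spdo_eqI) (simp add: coeff_mulop_mult coeff_mulop delta_def)

lemma mulop_add: "mulop (a + b) = mulop a + mulop b"
  by (rule spdo_eqI) (simp add: coeff_mulop delta_def)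

lemma mulop_0: "mulop 0 = 0"
  by (rule spdo_eqI) (simp add: coeff_mulop delta_def)

lemma sbinom_nonneg:
  "0 \<le> i \<Longrightarrow> sbinom i j = (if even i \<and> odd j then 0 else of_nat (nat (i div 2) choose (j div 2)))"
  by (simp add: sbinom_def binomial_gbinomial)

lemma sbinom_eq_0: "0 \<le> i \<Longrightarrow> i < int j \<Longrightarrow> sbinom i j = 0"
  by (auto simp: sbinom_nonneg binomial_eq_0_iff elim!: evenE oddE)

text \<open>Only \<open>j = i - n\<close> meets the single coefficient of \<open>mulop a\<close>;
  for \<open>j > i\<close> the superbinomial vanishes.\<close>

lemma coeff_Dop_mulop:
  assumes "0 \<le> i"
  shows "coeff (Dop i * mulop a) n
    = (if 0 \<le> n \<and> n \<le> i then const (sbinom i (nat (i - n))) * (sD ^^ nat (i - n)) (twist n a) else 0)"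
proof -
  have "(\<lambda>j. const (sbinom i j) * (sD ^^ j) (twist (i - int j) (delta 0 a (n - i + int j))))
      = (\<lambda>j. if j = nat (i - n) then
          (if 0 \<le> n \<and> n \<le> i then const (sbinom i (nat (i - n))) * (sD ^^ nat (i - n)) (twist n a) else 0) else 0)"
    using assms by (auto simp: fun_eq_iff delta_def sbinom_eq_0)
  then show ?thesis
    by (simp only: times_spdo.rep_eq coeff_Dop coeff_mulop comp_delta mult_1_left dpow_def Sum_any.delta)
qed

lemma sD_funpow_gen: "(sD ^^ j) (gen k) = gen (k + j)"
  by (induction j) (simp_all add: sD_gen)

text \<open>Found by solving linearly for the differential operators \<open>P\<close> with leading term \<open>9 \<D>\<^sup>1\<^sup>0\<close>, homogeneous when
  \<open>\<D>\<close> has weight 1 and \<open>\<phi>\<close> weight 3, for which \<open>[P, \<D>\<^sup>3 + \<phi>]\<close> has order 0.\<close>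

definition lax_P :: "'k::field_char_0 spdo" where
  "lax_P = mulop (const 9) * Dop 10 + mulop (const 15 * gen 1) * Dop 6 - mulop (const 15 * gen 2) * Dop 5
     + mulop (const 30 * gen 3) * Dop 4 - mulop (const 15 * gen 4) * Dop 3
     + mulop (const 25 * gen 5 + const 5 * (gen 1 * gen 1)) * Dop 2
     - mulop (const 10 * gen 6 + const 10 * (gen 1 * gen 2)) * Dop 1
     + mulop (const 10 * gen 7 + const 10 * (gen 1 * gen 3))"

lemma choose_table: "5 choose 2 = 10" "5 choose 3 = 10" "5 choose 4 = 5" "3 choose 2 = 3" "4 choose 2 = 6" "4 choose 3 = 4"
  by (simp_all add: eval_nat_numeral)

lemma coeff_term_mult_mulop: "0 \<le> i \<Longrightarrow> coeff (mulop c * Dop i * mulop a) n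
    = c * (if 0 \<le> n \<and> n \<le> i then const (sbinom i (nat (i - n))) * (sD ^^ nat (i - n)) (twist n a) else 0)"
  by (simp only: mult.assoc coeff_mulop_mult coeff_Dop_mulop)

lemma coeff_Dop_mult_term: "0 \<le> i \<Longrightarrow> coeff (Dop i * (mulop c * Dop k)) n
    = (let m = n - k in if 0 \<le> m \<and> m \<le> i then const (sbinom i (nat (i - m))) * (sD ^^ nat (i - m)) (twist m c) else 0)"
  by (simp only: mult.assoc[symmetric] coeff_mult_Dop coeff_Dop_mulop Let_def)

lemma sD_funpow_small: "(sD ^^ 2) x = sD (sD x)" "(sD ^^ 3) x = sD (sD (sD x))" "(sD ^^ Suc 0) x = sD x"
  by (simp_all add: numeral_2_eq_2 numeral_3_eq_3)

lemma sD_funpow_uminus: "(sD ^^ j) (- a) = - (sD ^^ j) a"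
  by (induction j) (simp_all add: sD_uminus)

lemma sD_diff: "sD (a - b) = sD a - sD b"
  using sD_add[of a "- b"] by (simp add: sD_uminus)

lemma twist_diff: "twist p (a - b) = twist p a - twist p b"
  using twist_add[of p a "- b"] by (simp add: twist_uminus)

text \<open>The guard \<open>j < i\<close> orients supercommutativity into a terminating rewrite
  rule that sorts monomials. \<open>gen i\<close> is odd exactly when \<open>i\<close> is
  even.\<close>

lemma gen_sort:
  "j < i \<Longrightarrow> gen i * gen j = (if even i \<and> even j then - (gen j * gen i) else gen j * gen i)"
  using gen_commute[of i j] by (auto simp: sgp_def)

lemma gen_sort_lc:
  "j < i \<Longrightarrow> gen i * (gen j * a) = (if even i \<and> even j then - (gen j * (gen i * a)) else gen j * (gen i * a))"
  by (simp only: mult.assoc[symmetric] gen_sort[of j i] if_distrib[of "\<lambda>x. x * a"] mult_minus_left)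

lemma gen_square:
  assumes "even i"
  shows "gen i * gen i = 0"
proof -
  have "gen i * gen i + gen i * gen i = (0 :: 'a sdpoly)"
    using gen_commute[of i i, where 'k = 'a] assms by (simp add: sgp_def eq_neg_iff_add_eq_0)
  moreover have "const (1 / 2 + 1 / 2) * (gen i * gen i) = (const (1 / 2) * (gen i * gen i + gen i * gen i) :: 'a sdpoly)"
    by (simp only: const_add distrib_left distrib_right)
  ultimately show ?thesis by simp
qed

lemma const_gen_left: "gen i * const c = const c * gen i" "gen i * (const c * a) = const c * (gen i * a)"
  "const c * (const d * a) = const (c * d) * a"
  by (rule const_central[symmetric], rule const_lc, simp add: const_mult mult.assoc)

lemma lookup_single_0_mult:
  fixes f :: "word \<Rightarrow>\<^sub>0 'k::field_char_0"
  shows "lookup (single 0 c * f) w = c * lookup f w"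
  by (induction f rule: pm_induct) (simp_all add: mult_single lookup_add distrib_left lookup_single when_def)

lemma lookup_numeral_mult:
  fixes f :: "word \<Rightarrow>\<^sub>0 'k::field_char_0"
  shows "lookup (numeral v * f) w = numeral v * lookup f w"
  using lookup_single_0_mult[of "numeral v" f w] by simp

text \<open>Enough once both sides are combinations of the same sorted monomials, where the
  relations of the ideal have been used up.\<close>

lemma sc_rel_pointwise: "(\<And>w. lookup f w = lookup g w) \<Longrightarrow> sc_rel f g"
  using poly_mapping_eqI[of f g] by (simp add: sc_rel_def sc_ideal.zero)

text \<open>The \<open>K\<close> of the overview. As \<open>gen k\<close> is the \<open>k\<close>-th
  super derivative of \<open>phi\<close>, the fifth x-derivative is \<open>gen 10\<close>.\<close>

definition sk :: "'k::field_char_0 sdpoly" where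
  "sk = gen 10 + const 5 * gen 6 * gen 1 + const 5 * gen 4 * gen 3 + const 5 * gen 2 * gen 1 * gen 1"

lemma lax_P_commutator:
  "lax_P * (Dop 3 + mulop (gen 0)) - (Dop 3 + mulop (gen 0)) * lax_P = - mulop sk"
proof (rule spdo_eqI)
  fix n :: int
  \<comment> \<open>Each coefficient reduces to a linear identity between sorted monomials. The algebra is not
    commutative, so like terms are collected in the field, coordinatewise in the free algebra.\<close>
  note S = lax_P_def sk_def distrib_left distrib_right left_diff_distrib right_diff_distrib coeff_mult_Dop
    coeff_mulop delta_def coeff_mulop_mult coeff_Dop_mult_term coeff_term_mult_mulop sbinom_nonneg choose_table
    sD_funpow_small sD_funpow_gen sD_funpow_uminus sD_gen twist_gen sgp_def mulop_mult coeff_Dop_mulop coeff_Dop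
    sD_add sD_diff sD_mult twist_add twist_diff twist_mult sD_uminus twist_uminus const_mult[symmetric] sD_const
    gen_sort gen_sort_lc gen_square const_gen_left mult.assoc numeral_2_eq_2[symmetric]
  \<comment> \<open>Both products are differential operators of order at most 10 + 3.\<close>
  have "n < 0 \<or> 13 < n \<or> n = 0 \<or> n = 1 \<or> n = 2 \<or> n = 3 \<or> n = 4 \<or> n = 5 \<or> n = 6 \<or> n = 7
      \<or> n = 8 \<or> n = 9 \<or> n = 10 \<or> n = 11 \<or> n = 12 \<or> n = 13"
    by presburger
  then show "coeff (lax_P * (Dop 3 + mulop (gen 0)) - (Dop 3 + mulop (gen 0)) * lax_P) n = coeff (- mulop sk :: 'a spdo) n"
    by (elim disjE) (simp add: S; (transfer, rule sc_rel_pointwise,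
          simp add: lookup_add lookup_minus lookup_single_0_mult lookup_numeral_mult))+
qed

text \<open>Oddness of \<open>a\<close> cancels the terms in \<D>^3. The right-hand side is the
  common shape of the lower part of \<open>lax_op\<close>, of its time derivative and, up to sign,
  of its commutator with \<open>lax_P\<close>.\<close>

lemma Dop_3_mulop_odd:
  assumes "homog 1 a"
  shows "Dop 3 * mulop a + mulop a * Dop 3 = mulop (sD a) * Dop 2 - mulop (dx a) * Dop 1 + mulop (sD (dx a))"
proof (rule spdo_eqI)
  fix n :: int
  have "n < 0 \<or> 3 < n \<or> n = 0 \<or> n = 1 \<or> n = 2 \<or> n = 3" by presburger
  then show "coeff (Dop 3 * mulop a + mulop a * Dop 3) n
      = coeff (mulop (sD a) * Dop 2 - mulop (dx a) * Dop 1 + mulop (sD (dx a))) n"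
    by (elim disjE; simp add: coeff_Dop_mulop coeff_mult_Dop coeff_mulop delta_def twist_homog[OF assms] sgp_def
        sbinom_nonneg choose_table sD_funpow_small sD_funpow_uminus sD_uminus dx_def numeral_2_eq_2[symmetric])
qed

lemma odd_mult_anticommute:
  assumes "homog 1 a"
  shows "a * phi + phi * a = 0"
  using homog_gen_commute[OF assms, of 0] by (simp add: phi_def sgp_def)

lemma lax_factor_mult_odd:
  assumes "homog 1 a"
  shows "(Dop 3 + mulop phi) * mulop a + mulop a * (Dop 3 + mulop phi)
    = mulop (sD a) * Dop 2 - mulop (dx a) * Dop 1 + mulop (sD (dx a))"
proof -
  have "mulop phi * mulop a + mulop a * mulop phi = 0"
    using odd_mult_anticommute[OF assms] by (simp only: mulop_mult mulop_add[symmetric] add.commute mulop_0)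
  then show ?thesis
    unfolding Dop_3_mulop_odd[OF assms, symmetric] by (simp add: distrib_left distrib_right algebra_simps)
qed

section \<open>The Lax operator and its commutators\<close>

lemma lax_op_square: "lax_op = (Dop 3 + mulop phi) * (Dop 3 + mulop phi)"
  by (simp add: lax_op_def Dop_power)

lemma lax_op_eq: "lax_op = Dop 6 + (mulop (sD phi) * Dop 2 - mulop (dx phi) * Dop 1 + mulop (sD (dx phi)))"
proof -
  have "lax_op = Dop 6 + (Dop 3 * mulop phi + mulop phi * Dop 3) + mulop phi * mulop phi"
    by (simp add: lax_op_square distrib_left distrib_right Dop_mult_Dop)
  then show ?thesis
    by (simp add: Dop_3_mulop_odd[OF phi_odd] mulop_mult gen_square[of 0, folded phi_def] mulop_0)
qed

lemma coeff_lax_op: "coeff lax_op n = (if n = 6 then 1 else if n = 2 then sD phi else if n = 1 then - dx phi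
    else if n = 0 then sD (dx phi) else 0)"
  by (simp add: lax_op_eq coeff_Dop coeff_mult_Dop coeff_mulop delta_def)

lemma monic_lax_op: "monic 6 lax_op"
  by (simp add: monic_def ord_le_def bdd_def coeff_lax_op)

lemma homog_op_lax_op: "homog_op 0 lax_op"
proof -
  have "homog_op 1 (Dop 3 + mulop phi)"
    using homog_op_mulop_Dop[of 1 0 phi] phi_odd by (intro homog_op_add) (simp_all add: homog_op_Dop Dop_0)
  from homog_op_cong[OF homog_op_mult[OF this this], of 0] show ?thesis by (simp add: lax_op_square)
qed

text \<open>Rules out the anticommutator branch of \<open>supercomm\<close>: an odd leading
  coefficient 1 would give 1 = -1.\<close>

lemma not_homog_op_1_lax_op: "\<not> homog_op 1 (lax_op :: 'k::field_char_0 spdo)"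
proof
  assume "homog_op 1 (lax_op :: 'k spdo)"
  then have "homog (1 - 6) (coeff (lax_op :: 'k spdo) 6)" unfolding homog_op_def by (rule spec)
  then have "homog (- 5) (1 :: 'k sdpoly)" by (simp add: coeff_lax_op)
  from twist_homog[OF this, of 1] have "(1 :: 'k sdpoly) = - 1" by (simp add: sgp_def)
  then have "const_term (1 :: 'k sdpoly) = const_term (- 1 :: 'k sdpoly)" by (rule arg_cong)
  then show False by simp
qed

lemma coeff_numeral_mult: "coeff (numeral v * A) n = numeral v * coeff A n"
  by (induction v) (simp_all only: numeral.simps distrib_right coeff_simps mult_1)

text \<open>\<D>^6 is the cube of the x-derivative, so the Leibniz rule yields the factor 3. The
  rest of \<open>lax_op\<close> has order at most 2 and reaches only order
  \<open>k + 2\<close>.\<close>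

lemma coeff_lax_op_commutator:
  assumes "ord_le k A"
  shows "coeff (A * lax_op - lax_op * A) (k + 4) = - (const 3 * dx (coeff A k))"
proof -
  define M :: "'a spdo" where "M = mulop (sD phi) * Dop 2 - mulop (dx phi) * Dop 1 + mulop (sD (dx phi))"
  have M: "ord_le 2 M" by (simp add: M_def ord_le_def bdd_def coeff_mult_Dop coeff_mulop delta_def)
  \<comment> \<open>Terms with \<open>j \<ge> 3\<close> would need coefficients of \<open>A\<close>
    above \<open>k\<close>; the one with \<open>j = 1\<close> vanishes because 6 is even.\<close>
  have b: "bdd k (coeff A)" "k < (k + 4) - 6 + int 3" using assms by (simp_all add: ord_le_def)
  have "coeff (Dop 6 * A) (k + 4) = dpow 6 (coeff A) (k + 4)"
    by (simp add: times_spdo.rep_eq coeff_Dop comp_delta)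
  also have "\<dots> = coeff A (k - 2) + const 3 * dx (coeff A k)"
    unfolding dpow_sum[OF b]
    by (simp add: numeral_3_eq_3 sbinom_nonneg twist_even dx_def add.commute)
  finally have 1: "coeff (Dop 6 * A) (k + 4) = coeff A (k - 2) + const 3 * dx (coeff A k)" .
  have 2: "coeff (A * M) (k + 4) = 0" "coeff (M * A) (k + 4) = 0"
    using ord_le_mult[OF assms M] ord_le_mult[OF M assms] by (auto elim: ord_leD)
  have 3: "coeff (A * Dop 6) (k + 4) = coeff A (k - 2)" by (simp add: coeff_mult_Dop)
  show ?thesis
    unfolding lax_op_eq M_def[symmetric] by (simp add: distrib_left distrib_right 1 2 3)
qed

lemma aug_eq_Dop_iff: "aug A = Dop k \<longleftrightarrow> (\<forall>n. const_term (coeff A n) = (if n = k then 1 else 0))"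
proof
  assume "aug A = Dop k"
  then have "const_term (coeff (aug A) n) = const_term (coeff (Dop k) n)" for n by simp
  then show "\<forall>n. const_term (coeff A n) = (if n = k then 1 else 0)"
    by (simp add: coeff_aug coeff_Dop delta_def)
qed (auto intro!: spdo_eqI simp: coeff_aug coeff_Dop delta_def)

lemma coeff_lax_P_0: "n < 0 \<or> 10 < n \<Longrightarrow> coeff lax_P n = 0" "coeff lax_P 10 = 9"
  by (auto simp: lax_P_def coeff_mult_Dop coeff_mulop delta_def const_numeral)

lemma const_term_lax_P: "n \<noteq> 10 \<Longrightarrow> const_term (coeff lax_P n) = 0"
  by (simp add: lax_P_def coeff_mult_Dop coeff_mulop delta_def)

lemma homog_sk: "homog 1 sk"
proof -
  have "homog 1 (gen 10)" by (rule homog_gen) simp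
  moreover have "homog (0 + 7 + 2) (const 5 * gen 6 * gen 1)"
    by (intro homog_mult homog_gen homog_const) simp_all
  moreover have "homog (0 + 5 + 4) (const 5 * gen 4 * gen 3)"
    by (intro homog_mult homog_gen homog_const) simp_all
  moreover have "homog (0 + 3 + 2 + 2) (const 5 * gen 2 * gen 1 * gen 1)"
    by (intro homog_mult homog_gen homog_const) simp_all
  ultimately show ?thesis
    unfolding sk_def by (intro homog_add) (erule homog_cong; simp)+
qed

lemma lax_P_lax_op: "lax_P * lax_op - lax_op * lax_P
    = - (mulop (sD sk) * Dop 2 - mulop (dx sk) * Dop 1 + mulop (sD (dx sk)))"
proof -
  define Q :: "'a spdo" where "Q = Dop 3 + mulop phi"
  have c: "lax_P * Q - Q * lax_P = - mulop sk"
    using lax_P_commutator by (simp add: Q_def phi_def)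
  have "lax_P * (Q * Q) - (Q * Q) * lax_P = (lax_P * Q - Q * lax_P) * Q + Q * (lax_P * Q - Q * lax_P)"
    by (simp add: algebra_simps)
  also have "\<dots> = - (Q * mulop sk + mulop sk * Q)"
    unfolding c by (simp add: algebra_simps)
  finally show ?thesis
    unfolding lax_op_square Q_def lax_factor_mult_odd[OF homog_sk] .
qed

lemma numeral_central: "A * numeral v = numeral v * (A :: 'a::ring_1)"
  by (metis mult_of_nat_commute of_nat_numeral)

section \<open>The differential part of the fifth power of the cube root\<close>

context
  fixes R :: "'k::field_char_0 spdo"
  assumes R: "is_cube_root R lax_op"
begin

lemma monic_R: "monic 2 R"
  using R by (simp add: is_cube_root_def monic_def ord_le_def bdd_def)

lemma R_cube: "R ^ 3 = lax_op"
  using R by (simp add: is_cube_root_def)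

text \<open>Both sides are monic cube roots of \<D>^6, so uniqueness applies.\<close>

lemma aug_R: "aug R = Dop 2"
proof (rule cube_inj)
  have "aug (lax_op :: 'k spdo) = Dop 6"
    by (simp add: aug_eq_Dop_iff coeff_lax_op phi_def)
  then show "aug R ^ 3 = Dop 2 ^ 3"
    by (simp add: aug_power[symmetric] R_cube Dop_power)
qed (simp_all add: monic_aug monic_R monic_Dop)

lemma const_term_R_power: "const_term (coeff (R ^ 5) n) = (if n = 10 then 1 else 0)"
  using aug_eq_Dop_iff[of "R ^ 5" 10] by (simp add: aug_power aug_R Dop_power)

lemma monic_R_power: "monic 10 (R ^ 5)"
proof -
  have "monic (2 * int n) (R ^ n)" for n
  proof (induction n)
    case 0
    show ?case using monic_Dop[of 0] by (simp add: Dop_0)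
  next
    case (Suc n)
    show ?case using monic_mult[OF monic_R Suc] by (simp add: algebra_simps)
  qed
  from this[of 5] show ?thesis by simp
qed

lemma diff_part_R_power: "9 * diff_part (R ^ 5) = lax_P"
proof -
  define A where "A = lax_P - 9 * R ^ 5"
  \<comment> \<open>The order descends from 9 to -1. In each step \<open>?k \<ge> 0\<close>, so
    \<open>?k + 4\<close> exceeds 2, the bound on the order of the commutator of
    \<open>lax_P\<close> with \<open>lax_op\<close>.\<close>
  have "ord_le (9 - int m) A" if "m \<le> 10" for m
    using that
  proof (induction m)
    case 0
    have "ord_le 10 A" "coeff A 10 = 0"
      using monic_R_power
      by (auto simp: A_def ord_le_def bdd_def coeff_numeral_mult coeff_lax_P_0 monic_def)
    from ord_le_drop[OF this] show ?case by simp
  next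
    case (Suc m)
    let ?k = "9 - int m"
    have o: "ord_le ?k A" using Suc by simp
    have "R ^ 5 * lax_op = lax_op * R ^ 5"
      by (simp flip: R_cube power_add)
    then have "A * lax_op - lax_op * A = lax_P * lax_op - lax_op * lax_P"
      by (simp add: A_def left_diff_distrib right_diff_distrib)
         (metis mult.assoc numeral_central)
    moreover have "coeff (lax_P * lax_op - lax_op * lax_P :: 'k spdo) (?k + 4) = 0"
      using Suc.prems unfolding lax_P_lax_op by (simp add: coeff_mult_Dop coeff_mulop delta_def)
    ultimately have "const 3 * dx (coeff A ?k) = 0"
      using coeff_lax_op_commutator[OF o] by simp
    then have "const (1 / 3) * (const 3 * dx (coeff A ?k)) = 0" by simp
    then have "dx (coeff A ?k) = 0" by (simp flip: mult.assoc const_mult)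
    then have "coeff A ?k = const (const_term (coeff A ?k))" by (rule dx_eq_0)
    also have "const_term (coeff A ?k) = 0"
      by (simp add: A_def const_term_lax_P coeff_numeral_mult const_term_R_power)
    finally have "coeff A ?k = 0" by simp
    from ord_le_drop[OF o this] show ?case by (simp add: algebra_simps)
  qed
  from this[of 10] have "ord_le (- 1) A" by simp
  then have "coeff A n = 0" if "0 \<le> n" for n using that by (auto elim: ord_leD)
  then show ?thesis
    by (intro spdo_eqI) (auto simp: A_def coeff_numeral_mult coeff_diff_part coeff_lax_P_0)
qed

end


subsection \<open>The Lax equation\<close>

lemma dx_funpow_gen: "(dx ^^ n) (gen k) = gen (k + 2 * n)"
  by (induction n) (simp_all add: dx_gen)

lemma sk_eq: "(dx ^^ 5) phi + 5 * (dx ^^ 3) phi * sD phi + 5 * (dx ^^ 2) phi * sD (dx phi) + 5 * dx phi * (sD phi)\<^sup>2 = sk"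
  unfolding sk_def phi_def dx_funpow_gen
  by (simp add: dx_gen sD_gen const_numeral power2_eq_square mult.assoc numeral_2_eq_2[symmetric])

lemma const_term_sk: "const_term sk = 0"
  by (simp add: sk_def)

lemma supercomm_lax_op: "supercomm A lax_op = A * lax_op - lax_op * A"
  by (simp add: supercomm_def not_homog_op_1_lax_op)

lemma coeff_coeffwise:
  assumes "d 0 = 0"
  shows "coeff (coeffwise d A) n = d (coeff A n)"
proof -
  obtain N where "ord_le N A" using ord_le_ex by blast
  then have "coeff (coeffwise d A) = (\<lambda>n. d (coeff A n))"
    unfolding coeffwise_def by (intro Spdo_inverse) (auto simp: ord_leD assms intro!: exI[of _ N])
  then show ?thesis by simp
qed

lemma coeffwise_lax_op:
  assumes d: "even_derivation d" and comm: "\<And>a. d (sD a) = sD (d a)"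
  shows "coeffwise d lax_op = mulop (sD (d phi)) * Dop 2 - mulop (dx (d phi)) * Dop 1 + mulop (sD (dx (d phi)))"
proof -
  have add: "d (a + b) = d a + d b" and mult: "d (a * b) = d a * b + a * d b" for a b
    using d by (auto simp: even_derivation_def)
  have d0: "d 0 = 0" using add[of 0 0] by simp
  have d1: "d 1 = 0" using mult[of 1 1] by simp
  have dm: "d (- a) = - d a" for a using add[of a "- a"] by (simp add: d0 eq_neg_iff_add_eq_0 add.commute)
  show ?thesis
    by (rule spdo_eqI)
       (simp add: coeff_coeffwise d0 d1 dm coeff_lax_op coeff_mult_Dop coeff_mulop delta_def dx_def comm)
qed

text \<open>The coefficient of \<D>^2 gives the condition; the other two coefficients are super
  derivatives of it.\<close>

lemma lax_form_eq_iff: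
  "mulop (sD a) * Dop 2 - mulop (dx a) * Dop 1 + mulop (sD (dx a))
    = - (mulop (sD b) * Dop 2 - mulop (dx b) * Dop 1 + mulop (sD (dx b))) \<longleftrightarrow> sD (a + b) = 0" (is "?l a = - ?l b \<longleftrightarrow> _")
proof
  assume "?l a = - ?l b"
  then have "coeff (?l a) 2 = coeff (- ?l b) 2" by simp
  then show "sD (a + b) = 0" by (simp add: coeff_mult_Dop coeff_mulop delta_def sD_add)
next
  assume 0: "sD (a + b) = 0"
  have "?l a + ?l b = ?l (a + b)"
    by (simp add: sD_add dx_add mulop_add distrib_right)
  also have "\<dots> = 0" using 0 by (simp add: dx_def mulop_0)
  finally show "?l a = - ?l b" unfolding eq_neg_iff_add_eq_0 .
qed

theorem mainTheorem1:
  fixes dt :: "'k::field_char_0 sdpoly \<Rightarrow> 'k sdpoly"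
  assumes "even_derivation dt"
    and "\<forall>a. dt (sD a) = sD (dt a)"
    and "const_term (dt phi) = 0"
  shows "lax_op = (Dop 2 ^ 3 + mulop (sD phi) * Dop 2 - mulop (dx phi) * Dop 1
                    + mulop (sD (dx phi)) :: 'k spdo)
    \<and> (coeffwise dt lax_op = supercomm (9 * diff_part (cube_root lax_op ^ 5)) lax_op
       \<longleftrightarrow> dt phi + (dx ^^ 5) phi + 5 * (dx ^^ 3) phi * sD phi + 5 * (dx ^^ 2) phi * sD (dx phi)
             + 5 * dx phi * (sD phi)^2 = 0)"
proof
  show "lax_op = (Dop 2 ^ 3 + mulop (sD phi) * Dop 2 - mulop (dx phi) * Dop 1 + mulop (sD (dx phi)) :: 'k spdo)"
    by (simp add: lax_op_eq Dop_power)
next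
  have "is_cube_root (cube_root lax_op) (lax_op :: 'k spdo)"
    by (rule is_cube_root_cube_root[OF monic_lax_op homog_op_lax_op])
  then have "9 * diff_part (cube_root lax_op ^ 5) = (lax_P :: 'k spdo)" by (rule diff_part_R_power)
  then have "coeffwise dt lax_op = supercomm (9 * diff_part (cube_root lax_op ^ 5)) lax_op \<longleftrightarrow> sD (dt phi + sk) = 0"
    using assms(2)
    by (simp only: supercomm_lax_op lax_P_lax_op coeffwise_lax_op[OF assms(1)] lax_form_eq_iff)
  also have "\<dots> \<longleftrightarrow> dt phi + sk = 0"
    \<comment> \<open>\<open>sD\<close> also kills constants, which the hypothesis on the constant
      term of \<open>dt phi\<close> excludes.\<close>
    using sD_eq_0[of "dt phi + sk"] assms(3) by (auto simp: const_term_sk)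
  finally show "coeffwise dt lax_op = supercomm (9 * diff_part (cube_root lax_op ^ 5)) lax_op
       \<longleftrightarrow> dt phi + (dx ^^ 5) phi + 5 * (dx ^^ 3) phi * sD phi + 5 * (dx ^^ 2) phi * sD (dx phi)
             + 5 * dx phi * (sD phi)^2 = 0"
    by (simp only: sk_eq[symmetric] add.assoc)
qed

end
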